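(* Let $\Pi:L^2(\partial\mathbb{B})\to L^2_s(\partial\mathbb{B})$ be the orthogonal projection of the space of quaternion-valued $L^2$ functions on the unit sphere $\partial\mathbb{B}$ of the quaternions onto the closed subspace of slice $L^2$ functions, and for $1\le p\le\infty$ let $$\|\Pi\|_{p,p}=\sup\left\{\frac{\|\Pi\varphi\|_p}{\|\varphi\|_p}:\ \varphi\in L^2\cap L^p,\ \varphi\neq 0\right\}.$$ Then: (i) $\|\Pi\|_{2,2}=1$ and $\|\Pi\|_{\infty,\infty}=\frac{4}{3}$. (ii) If $2\le p\le\infty$, then $\|\Pi\|_{p,p}\le 2\left(\frac{2p-2}{3p-2}\right)^{\frac{p-1}{p}}$, where for $p=\infty$ the right-hand side is understood as its limit $\frac43$ as $p\to\infty$. (iii) If $1\le p,q\le\infty$ and $\frac1p+\frac1q=1$, then $\|\Pi\|_{p,p}=\|\Pi\|_{q,q}$.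
   Context: $\mathbb{H}=\mathbb{R}+\mathbb{R}i+\mathbb{R}j+\mathbb{R}k$ is the algebra of quaternions, $\mathbb{B}=\{q\in\mathbb{H}:|q|<1\}$, and $\mathbb{S}=\{q\in\mathbb{H}:q^2=-1\}$ is the 2-sphere of imaginary units, with $\sigma$ its area measure normalized so that $\sigma(\mathbb{S})=1$. Each point of $\partial\mathbb{B}$ has the form $e^{It}=\cos t+I\sin t$ with $I\in\mathbb{S}$, $t\in\mathbb{R}$. The sphere $\partial\mathbb{B}$ carries the probability measure $\Sigma$ given by $$\int_{\partial\mathbb{B}}g\,d\Sigma=\frac{1}{2\pi}\int_0^{2\pi}\int_{\mathbb{S}}g(e^{It})\,d\sigma(I)\,dt$$ (this is not the usual surface measure on the 3-sphere). $L^p=L^p(\partial\mathbb{B})$, $1\le p\le\infty$, is the space of measurable $\varphi:\partial\mathbb{B}\to\mathbb{H}$ with $\|\varphi\|_p<\infty$, the norm being taken with respect to $\Sigma$ (essential supremum of $|\varphi|$ for $p=\infty$). $L^2$ is a right quaternionic Hilbert space with inner product $\langle f,g\rangle=\int_{\partial\mathbb{B}}\overline{g}\,f\,d\Sigma$. A function $f:\partial\mathbb{B}\to\mathbb{H}$ is a slice function if for all $I,J\in\mathbb{S}$ and $t\in\mathbb{R}$, $f(e^{Jt})=\frac12[f(e^{It})+f(e^{-It})]+\frac{JI}{2}[f(e^{-It})-f(e^{It})]$; equivalently, $f(e^{Jt})=a(t)+Jb(t)$ for $\mathbb{H}$-valued functions $a,b$ depending on $t$ alone. $L^p_s$ is the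 set of elements of $L^p$ that are (represented by) measurable slice functions. $L^2_s$ is a closed subspace of $L^2$. *)

theory Defs
  imports "HOL-Probability.Probability" "HOL-Real_Asymp.Real_Asymp"
begin

section \<open>Quaternions\<close>

datatype quaternion =
  Quat (Re_quat: real) (Im_i: real) (Im_j: real) (Im_k: real)

lemma quaternion_eq_iff:
  "p = q \<longleftrightarrow> Re_quat p = Re_quat q \<and> Im_i p = Im_i q \<and> Im_j p = Im_j q \<and> Im_k p = Im_k q"
  by (auto intro: quaternion.expand)

instantiation quaternion :: ring_1
begin

definition "0 = Quat 0 0 0 0"
definition "1 = Quat 1 0 0 0"
definition "p + q = Quat (Re_quat p + Re_quat q) (Im_i p + Im_i q) (Im_j p + Im_j q) (Im_k p + Im_k q)"
definition "- p = Quat (- Re_quat p) (- Im_i p) (- Im_j p) (- Im_k p)"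
definition "p - q = Quat (Re_quat p - Re_quat q) (Im_i p - Im_i q) (Im_j p - Im_j q) (Im_k p - Im_k q)"
definition
  "p * q = Quat
     (Re_quat p * Re_quat q - Im_i p * Im_i q - Im_j p * Im_j q - Im_k p * Im_k q)
     (Re_quat p * Im_i q + Im_i p * Re_quat q + Im_j p * Im_k q - Im_k p * Im_j q)
     (Re_quat p * Im_j q - Im_i p * Im_k q + Im_j p * Re_quat q + Im_k p * Im_i q)
     (Re_quat p * Im_k q + Im_i p * Im_j q - Im_j p * Im_i q + Im_k p * Re_quat q)"

lemmas quaternion_arith_defs =
  zero_quaternion_def one_quaternion_def plus_quaternion_def
  uminus_quaternion_def minus_quaternion_def times_quaternion_def

instance
  by standard (simp_all add: quaternion_eq_iff quaternion_arith_defs algebra_simps)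

end

lemma quaternion_sel [simp]:
  "Re_quat 0 = 0" "Im_i 0 = 0" "Im_j 0 = 0" "Im_k 0 = 0"
  "Re_quat 1 = 1" "Im_i 1 = 0" "Im_j 1 = 0" "Im_k 1 = 0"
  "Re_quat (p + q) = Re_quat p + Re_quat q" "Im_i (p + q) = Im_i p + Im_i q"
  "Im_j (p + q) = Im_j p + Im_j q" "Im_k (p + q) = Im_k p + Im_k q"
  "Re_quat (- p) = - Re_quat p" "Im_i (- p) = - Im_i p"
  "Im_j (- p) = - Im_j p" "Im_k (- p) = - Im_k p"
  "Re_quat (p - q) = Re_quat p - Re_quat q" "Im_i (p - q) = Im_i p - Im_i q"
  "Im_j (p - q) = Im_j p - Im_j q" "Im_k (p - q) = Im_k p - Im_k q"
  "Re_quat (p * q) = Re_quat p * Re_quat q - Im_i p * Im_i q - Im_j p * Im_j q - Im_k p * Im_k q"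
  "Im_i (p * q) = Re_quat p * Im_i q + Im_i p * Re_quat q + Im_j p * Im_k q - Im_k p * Im_j q"
  "Im_j (p * q) = Re_quat p * Im_j q - Im_i p * Im_k q + Im_j p * Re_quat q + Im_k p * Im_i q"
  "Im_k (p * q) = Re_quat p * Im_k q + Im_i p * Im_j q - Im_j p * Im_i q + Im_k p * Re_quat q"
  by (simp_all add: quaternion_arith_defs)

definition quat_cnj :: "quaternion \<Rightarrow> quaternion" where
  "quat_cnj q = Quat (Re_quat q) (- Im_i q) (- Im_j q) (- Im_k q)"

instantiation quaternion :: real_algebra_1
begin

definition "scaleR r q = Quat (r * Re_quat q) (r * Im_i q) (r * Im_j q) (r * Im_k q)"

instance
  by standard (simp_all add: scaleR_quaternion_def quaternion_eq_iff algebra_simps)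

end

lemma quaternion_scaleR_sel [simp]:
  "Re_quat (r *\<^sub>R q) = r * Re_quat q" "Im_i (r *\<^sub>R q) = r * Im_i q"
  "Im_j (r *\<^sub>R q) = r * Im_j q" "Im_k (r *\<^sub>R q) = r * Im_k q"
  by (simp_all add: scaleR_quaternion_def)

instantiation quaternion :: real_inner
begin

definition
  "inner p q = Re_quat p * Re_quat q + Im_i p * Im_i q + Im_j p * Im_j q + Im_k p * Im_k q"
definition "norm q = sqrt ((Re_quat q)\<^sup>2 + (Im_i q)\<^sup>2 + (Im_j q)\<^sup>2 + (Im_k q)\<^sup>2)"
definition "sgn q = q /\<^sub>R norm q" for q :: quaternion
definition "dist p q = norm (p - q)" for p q :: quaternion
definition "uniformity = (INF e\<in>{0<..}. principal {(p :: quaternion, q). dist p q < e})"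
definition "open U \<longleftrightarrow> (\<forall>p\<in>U. eventually (\<lambda>(p', q). p' = p \<longrightarrow> q \<in> U) uniformity)"
  for U :: "quaternion set"

instance
proof
  fix p q s :: quaternion and a b :: real and U :: "quaternion set"
  show "inner p p = 0 \<longleftrightarrow> p = 0"
    unfolding inner_quaternion_def quaternion_eq_iff
    by (simp add: add_nonneg_eq_0_iff)
  show "0 \<le> inner p p"
    by (simp add: inner_quaternion_def)
  show "norm p = sqrt (inner p p)"
    by (simp add: inner_quaternion_def norm_quaternion_def power2_eq_square)
qed (simp_all add: quaternion_eq_iff inner_quaternion_def
      sgn_quaternion_def dist_quaternion_def uniformity_quaternion_def open_quaternion_def
      algebra_simps)

end

instantiation quaternion :: real_normed_div_algebra
begin

definition "inverse q = quat_cnj q /\<^sub>R (norm q)\<^sup>2"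
definition "divide p q = p * inverse q" for p q :: quaternion

instance
proof
  fix p q :: quaternion
  show "p div q = p * inverse q"
    by (simp add: divide_quaternion_def)
  show "inverse (0 :: quaternion) = 0"
    by (simp add: inverse_quaternion_def quaternion_eq_iff quat_cnj_def)
  show "norm (p * q) = norm p * norm q"
    unfolding norm_quaternion_def real_sqrt_mult [symmetric]
    by (rule arg_cong [where f = sqrt]) (simp only: quaternion_sel, algebra)
next
  fix q :: quaternion
  assume "q \<noteq> 0"
  moreover have "quat_cnj q * q = (norm q)\<^sup>2 *\<^sub>R 1" "q * quat_cnj q = (norm q)\<^sup>2 *\<^sub>R 1"
    by (simp_all add: quaternion_eq_iff quat_cnj_def norm_quaternion_def power2_eq_square)
  ultimately show "inverse q * q = 1" "q * inverse q = 1"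
    by (simp_all add: inverse_quaternion_def)
qed

end

instantiation quaternion :: euclidean_space
begin

definition "Basis = {Quat 1 0 0 0, Quat 0 1 0 0, Quat 0 0 1 0, Quat 0 0 0 1}"

instance
proof
  show "(Basis :: quaternion set) \<noteq> {}" "finite (Basis :: quaternion set)"
    by (simp_all add: Basis_quaternion_def)
  show "inner u v = (if u = v then 1 else 0)" if "u \<in> Basis" "v \<in> Basis" for u v :: quaternion
    using that unfolding Basis_quaternion_def by (elim insertE emptyE) (simp_all add: inner_quaternion_def)
  show "(\<forall>u\<in>Basis. inner x u = 0) \<longleftrightarrow> x = 0" for x :: quaternion
    by (simp add: Basis_quaternion_def inner_quaternion_def quaternion_eq_iff [of x])
qed

end

section \<open>The measures on the sphere of imaginary units and on the unit sphere\<close>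

definition imag_units :: "quaternion set" where
  "imag_units = {q. q\<^sup>2 = -1}"

definition spherical_coords :: "real \<times> real \<Rightarrow> quaternion" where
  "spherical_coords = (\<lambda>(\<theta>, \<phi>). Quat 0 (sin \<theta> * cos \<phi>) (sin \<theta> * sin \<phi>) (cos \<theta>))"

text \<open>
  The area element of the unit 2-sphere in spherical coordinates is
  \<open>sin \<theta> d\<theta> d\<phi>\<close>, for \<open>\<theta>\<close> in \<open>[0, \<pi>]\<close> and \<open>\<phi>\<close> in
  \<open>[0, 2\<pi>]\<close>; dividing by the total area \<open>4\<pi>\<close> normalizes it.
\<close>

definition spherical_density :: "real \<times> real \<Rightarrow> ennreal" where
  "spherical_density = (\<lambda>(\<theta>, \<phi>).
     ennreal (sin \<theta> / (4 * pi)) * indicator ({0..pi} \<times> {0..2 * pi}) (\<theta>, \<phi>))"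

definition imag_units_area :: "quaternion measure" where
  "imag_units_area =
     distr (density lborel spherical_density) (restrict_space borel imag_units) spherical_coords"

definition slice_point :: "quaternion \<Rightarrow> real \<Rightarrow> quaternion" where
  "slice_point I t = of_real (cos t) + I * of_real (sin t)"

definition bdry_measure :: "quaternion measure" where
  "bdry_measure =
     distr (uniform_measure lborel {0..2 * pi} \<Otimes>\<^sub>M imag_units_area)
       (restrict_space borel (sphere 0 1)) (\<lambda>(t, I). slice_point I t)"

section \<open>Lebesgue spaces and slice functions\<close>

text \<open>
  Elements of the Lebesgue spaces are handled through representatives, i.e. functions
  measurable on the unit sphere; their values off the sphere are irrelevant.
\<close>

definition Lp_norm :: "ennreal \<Rightarrow> (quaternion \<Rightarrow> quaternion) \<Rightarrow> ennreal" where
  "Lp_norm p \<phi> =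
     (if p = \<infinity> then esssup bdry_measure (\<lambda>x. ennreal (norm (\<phi> x)))
      else let N = (\<integral>\<^sup>+ x. ennreal (norm (\<phi> x) powr enn2real p) \<partial>bdry_measure) in
        if N = \<infinity> then \<infinity> else ennreal (enn2real N powr (1 / enn2real p)))"

definition Lp_space :: "ennreal \<Rightarrow> (quaternion \<Rightarrow> quaternion) set" where
  "Lp_space p = {\<phi> \<in> borel_measurable bdry_measure. Lp_norm p \<phi> < \<infinity>}"

definition L2_inner ::
  "(quaternion \<Rightarrow> quaternion) \<Rightarrow> (quaternion \<Rightarrow> quaternion) \<Rightarrow> quaternion" where
  "L2_inner f g = (\<integral>x. quat_cnj (g x) * f x \<partial>bdry_measure)"

definition slice_function :: "(quaternion \<Rightarrow> quaternion) \<Rightarrow> bool" where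
  "slice_function f \<longleftrightarrow>
     (\<forall>I\<in>imag_units. \<forall>J\<in>imag_units. \<forall>t.
        f (slice_point J t) =
          (1 / 2) *\<^sub>R (f (slice_point I t) + f (slice_point I (- t))) +
          ((1 / 2) *\<^sub>R (J * I)) * (f (slice_point I (- t)) - f (slice_point I t)))"

definition slice_Lp_space :: "ennreal \<Rightarrow> (quaternion \<Rightarrow> quaternion) set" where
  "slice_Lp_space p =
     {\<phi> \<in> Lp_space p. \<exists>f \<in> borel_measurable bdry_measure.
        slice_function f \<and> (AE x in bdry_measure. \<phi> x = f x)}"

section \<open>The orthogonal projection and its operator norms\<close>

text \<open>
  A representative of the orthogonal projection; it is determined up to equality almost everywhere.
\<close>

definition slice_proj :: "(quaternion \<Rightarrow> quaternion) \<Rightarrow> quaternion \<Rightarrow> quaternion" where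
  "slice_proj \<phi> =
     (SOME \<psi>. \<psi> \<in> slice_Lp_space 2 \<and>
        (\<forall>g \<in> slice_Lp_space 2. L2_inner (\<lambda>x. \<phi> x - \<psi> x) g = 0))"

definition slice_proj_norm :: "ennreal \<Rightarrow> ennreal" where
  "slice_proj_norm p =
     (SUP \<phi> \<in> {\<phi> \<in> Lp_space 2 \<inter> Lp_space p. \<not> (AE x in bdry_measure. \<phi> x = 0)}.
        Lp_norm p (slice_proj \<phi>) / Lp_norm p \<phi>)"

definition slice_proj_bound :: "real \<Rightarrow> real" where
  "slice_proj_bound p = 2 * ((2 * p - 2) / (3 * p - 2)) powr ((p - 1) / p)"

lemma slice_proj_bound_at_top: "(slice_proj_bound \<longlongrightarrow> 4 / 3) at_top"
  unfolding slice_proj_bound_def by real_asymp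

section \<open>Basic facts on the measures\<close>

lemma quat_borel_measurable [measurable (raw)]:
  assumes "a \<in> borel_measurable M" "b \<in> borel_measurable M"
    "c \<in> borel_measurable M" "d \<in> borel_measurable M"
  shows "(\<lambda>x. Quat (a x) (b x) (c x) (d x)) \<in> borel_measurable M"
proof (rule borel_measurable_euclidean_space [THEN iffD2], rule ballI)
  fix e :: quaternion assume "e \<in> Basis"
  then show "(\<lambda>x. Quat (a x) (b x) (c x) (d x) \<bullet> e) \<in> borel_measurable M"
    using assms by (auto simp: Basis_quaternion_def inner_quaternion_def)
qed

lemma imag_units_iff:
  "I \<in> imag_units \<longleftrightarrow> Re_quat I = 0 \<and> (Im_i I)\<^sup>2 + (Im_j I)\<^sup>2 + (Im_k I)\<^sup>2 = 1"
proof -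
  have "Re_quat I = 0" if "I\<^sup>2 = - 1"
  proof (rule ccontr)
    assume r: "Re_quat I \<noteq> 0"
    from that have *: "Re_quat I * Re_quat I - Im_i I * Im_i I - Im_j I * Im_j I - Im_k I * Im_k I = - 1"
      "Re_quat I * Im_i I = 0" "Re_quat I * Im_j I = 0" "Re_quat I * Im_k I = 0"
      by (simp_all add: power2_eq_square quaternion_eq_iff mult.commute)
    with r have "Re_quat I * Re_quat I = - 1"
      by simp
    then show False
      using zero_le_square [of "Re_quat I"] by linarith
  qed
  moreover have "I\<^sup>2 = - 1 \<longleftrightarrow> (Im_i I)\<^sup>2 + (Im_j I)\<^sup>2 + (Im_k I)\<^sup>2 = 1" if "Re_quat I = 0"
    using that unfolding power2_eq_square quaternion_eq_iff by (simp; linarith)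
  ultimately show ?thesis
    unfolding imag_units_def by blast
qed

lemma spherical_coords_in_imag_units: "spherical_coords x \<in> imag_units"
proof -
  have "(sin a * cos b)\<^sup>2 + (sin a * sin b)\<^sup>2 + (cos a)\<^sup>2 = 1" for a b :: real
  proof -
    have "(sin a * cos b)\<^sup>2 + (sin a * sin b)\<^sup>2 + (cos a)\<^sup>2
        = (sin a)\<^sup>2 * ((sin b)\<^sup>2 + (cos b)\<^sup>2) + (cos a)\<^sup>2"
      by (simp only: power_mult_distrib distrib_left add.commute)
    then show ?thesis
      by simp
  qed
  then show ?thesis
    by (auto simp: spherical_coords_def imag_units_iff split: prod.split)
qed

lemma slice_point_in_sphere:
  assumes "I \<in> imag_units"
  shows "slice_point I t \<in> sphere 0 1"
proof -
  have I: "Re_quat I = 0" "(Im_i I)\<^sup>2 + (Im_j I)\<^sup>2 + (Im_k I)\<^sup>2 = 1"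
    using assms by (auto simp: imag_units_iff)
  have "(cos t)\<^sup>2 + (Im_i I * sin t)\<^sup>2 + (Im_j I * sin t)\<^sup>2 + (Im_k I * sin t)\<^sup>2
      = (cos t)\<^sup>2 + ((Im_i I)\<^sup>2 + (Im_j I)\<^sup>2 + (Im_k I)\<^sup>2) * (sin t)\<^sup>2"
    by (simp add: power_mult_distrib algebra_simps)
  also have "\<dots> = 1"
    by (simp add: I)
  finally show ?thesis
    by (simp add: slice_point_def norm_quaternion_def of_real_def I mult.commute)
qed

lemma space_imag_units_area [simp]: "space imag_units_area = imag_units"
  and sets_imag_units_area [simp, measurable_cong]:
    "sets imag_units_area = sets (restrict_space borel imag_units)"
  by (simp_all add: imag_units_area_def space_restrict_space)

lemma space_bdry_measure [simp]: "space bdry_measure = sphere 0 1"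
  and sets_bdry_measure [simp, measurable_cong]:
    "sets bdry_measure = sets (restrict_space borel (sphere 0 1))"
  by (simp_all add: bdry_measure_def space_restrict_space)

lemma measurable_spherical_coords [measurable]:
  "spherical_coords \<in> borel \<rightarrow>\<^sub>M restrict_space borel imag_units"
proof (rule measurable_restrict_space2)
  show "spherical_coords \<in> space borel \<rightarrow> imag_units"
    using spherical_coords_in_imag_units by auto
  have "(\<lambda>x. Quat 0 (sin (fst x) * cos (snd x)) (sin (fst x) * sin (snd x)) (cos (fst x)))
      \<in> borel_measurable (borel :: (real \<times> real) measure)"
    unfolding borel_prod [symmetric] by measurable
  then show "spherical_coords \<in> borel_measurable borel"
    by (simp add: spherical_coords_def case_prod_beta)
qed

lemma measurable_slice_point [measurable]:
  "(\<lambda>(t, I). slice_point I t) \<in>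
     (borel \<Otimes>\<^sub>M restrict_space borel imag_units) \<rightarrow>\<^sub>M restrict_space borel (sphere 0 1)"
proof (rule measurable_restrict_space2)
  show "(\<lambda>(t, I). slice_point I t) \<in> space (borel \<Otimes>\<^sub>M restrict_space borel imag_units) \<rightarrow> sphere 0 1"
    using slice_point_in_sphere by (auto simp: space_pair_measure space_restrict_space)
  have [measurable]: "(\<lambda>x. x) \<in> restrict_space borel imag_units \<rightarrow>\<^sub>M (borel :: quaternion measure)"
    by (simp add: measurable_restrict_space1)
  have "(\<lambda>x. of_real (cos (fst x)) + snd x * of_real (sin (fst x))) \<in>
      borel_measurable (borel \<Otimes>\<^sub>M restrict_space (borel :: quaternion measure) imag_units)"
    by measurable
  then show "(\<lambda>(t, I). slice_point I t) \<in>
      borel_measurable (borel \<Otimes>\<^sub>M restrict_space borel imag_units)"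
    by (simp add: slice_point_def case_prod_beta)
qed

lemma spherical_density_eq:
  "spherical_density x =
     (ennreal (sin (fst x) / (4 * pi)) * indicator {0..pi} (fst x)) * indicator {0..2 * pi} (snd x)"
  by (cases x) (simp add: spherical_density_def indicator_times mult.assoc)

lemma measurable_spherical_density [measurable]: "spherical_density \<in> borel_measurable borel"
  unfolding spherical_density_eq [abs_def] borel_prod [symmetric] by measurable

lemma nn_integral_sin_Icc:
  "(\<integral>\<^sup>+ \<theta>. ennreal (sin \<theta> / (4 * pi)) * indicator {0..pi} \<theta> \<partial>lborel) = ennreal (1 / (2 * pi))"
proof -
  have "(\<integral>\<^sup>+ \<theta>. ennreal (sin \<theta> / (4 * pi)) * indicator {0..pi} \<theta> \<partial>lborel)
      = ennreal ((- cos pi / (4 * pi)) - (- cos 0 / (4 * pi)))"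
    by (rule nn_integral_FTC_Icc)
      (auto intro!: derivative_eq_intros simp: sin_ge_zero
        simp flip: has_real_derivative_iff_has_vector_derivative)
  also have "(- cos pi / (4 * pi)) - (- cos 0 / (4 * pi)) = 1 / (2 * pi)"
    by (simp add: field_simps)
  finally show ?thesis .
qed

lemma nn_integral_spherical_density: "(\<integral>\<^sup>+ x. spherical_density x \<partial>lborel) = 1"
proof -
  have "(\<integral>\<^sup>+ x. spherical_density x \<partial>lborel) =
      (\<integral>\<^sup>+ \<theta>. \<integral>\<^sup>+ \<phi>. spherical_density (\<theta>, \<phi>) \<partial>lborel \<partial>lborel)"
    unfolding lborel_prod [symmetric]
    by (rule lborel.nn_integral_fst [symmetric]) (simp add: lborel_prod)
  also have "\<dots> =
      (\<integral>\<^sup>+ \<theta>. ennreal (sin \<theta> / (4 * pi)) * indicator {0..pi} \<theta> * ennreal (2 * pi) \<partial>lborel)"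
    unfolding spherical_density_eq by (intro nn_integral_cong) (simp add: nn_integral_cmult)
  also have "\<dots> = ennreal (1 / (2 * pi)) * ennreal (2 * pi)"
    by (subst nn_integral_multc) (simp_all add: nn_integral_sin_Icc)
  also have "\<dots> = 1"
    by (simp flip: ennreal_mult'')
  finally show ?thesis .
qed

lemma prob_space_imag_units_area: "prob_space imag_units_area"
proof -
  have "emeasure (density lborel spherical_density) UNIV = 1"
    by (subst emeasure_density) (simp_all add: nn_integral_spherical_density)
  then have "prob_space (density lborel spherical_density)"
    by (intro prob_spaceI) simp
  then show ?thesis
    unfolding imag_units_area_def
    by (rule prob_space.prob_space_distr) simp
qed

lemma prob_space_uniform_angle: "prob_space (uniform_measure lborel {0..2 * pi :: real})"
  by (rule prob_space_uniform_measure) simp_all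

lemma measurable_slice_point_pair:
  "(\<lambda>(t, I). slice_point I t) \<in>
     (uniform_measure lborel {0..2 * pi} \<Otimes>\<^sub>M imag_units_area) \<rightarrow>\<^sub>M restrict_space borel (sphere 0 1)"
proof -
  have eq: "sets (uniform_measure lborel {0..2 * pi} \<Otimes>\<^sub>M imag_units_area) =
      sets (borel \<Otimes>\<^sub>M restrict_space borel imag_units)"
    by (rule sets_pair_measure_cong) simp_all
  show ?thesis
    by (simp only: measurable_cong_sets [OF eq refl] measurable_slice_point)
qed

lemma prob_space_bdry_measure: "prob_space bdry_measure"
  unfolding bdry_measure_def
  by (rule prob_space.prob_space_distr [OF _ measurable_slice_point_pair])
    (rule prob_space_pair [OF prob_space_uniform_angle prob_space_imag_units_area])

lemma nn_integral_bdry_measure: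
  assumes [measurable]: "g \<in> borel_measurable bdry_measure"
  shows "(\<integral>\<^sup>+ x. g x \<partial>bdry_measure) =
    (\<integral>\<^sup>+ t. (\<integral>\<^sup>+ I. g (slice_point I t) \<partial>imag_units_area) * indicator {0..2 * pi} t \<partial>lborel) /
      ennreal (2 * pi)"
proof -
  interpret S: prob_space imag_units_area
    by (rule prob_space_imag_units_area)
  let ?U = "uniform_measure lborel {0..2 * pi}"
  have g: "g \<in> borel_measurable (restrict_space borel (sphere 0 1))"
    using assms by (simp only: measurable_cong_sets [OF sets_bdry_measure refl])
  note m = measurable_slice_point_pair
  have gm: "(\<lambda>x. g (slice_point (snd x) (fst x))) \<in> borel_measurable (?U \<Otimes>\<^sub>M imag_units_area)"
    using measurable_compose [OF m g] by (simp only: case_prod_beta)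
  have "(\<lambda>t. \<integral>\<^sup>+ I. g (slice_point I t) \<partial>imag_units_area) \<in> borel_measurable ?U"
    using S.borel_measurable_nn_integral_fst [OF gm] by (simp only: fst_conv snd_conv)
  moreover have "measurable ?U borel = measurable lborel (borel :: ennreal measure)"
    by (rule measurable_cong_sets) simp_all
  ultimately have inner:
    "(\<lambda>t. \<integral>\<^sup>+ I. g (slice_point I t) \<partial>imag_units_area) \<in> borel_measurable lborel"
    by simp
  have "(\<integral>\<^sup>+ x. g x \<partial>bdry_measure) =
      (\<integral>\<^sup>+ x. g (slice_point (snd x) (fst x)) \<partial>(?U \<Otimes>\<^sub>M imag_units_area))"
    using nn_integral_distr [OF m assms [unfolded bdry_measure_def]]
    by (simp only: case_prod_beta flip: bdry_measure_def)
  also have "\<dots> = (\<integral>\<^sup>+ t. \<integral>\<^sup>+ I. g (slice_point I t) \<partial>imag_units_area \<partial>?U)"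
    using S.nn_integral_fst [OF gm] by (simp only: fst_conv snd_conv)
  also have "\<dots> = (\<integral>\<^sup>+ t. (\<integral>\<^sup>+ I. g (slice_point I t) \<partial>imag_units_area) * indicator {0..2 * pi} t \<partial>lborel) /
      emeasure lborel {0..2 * pi}"
    by (rule nn_integral_uniform_measure [OF inner]) simp
  finally show ?thesis
    by simp
qed

end

theory Submission
  imports Defs
begin

text \<open>
  On almost every sphere of points \<open>e\<^sup>I\<^sup>t\<close>, with \<open>t\<close> in \<open>(0, \<pi>)\<close> fixed and \<open>I\<close> an imaginary unit, a slice
  function has the form \<open>a + I b\<close>. The imaginary units have mean \<open>0\<close> and satisfy \<open>I\<^sup>2 = -1\<close>, so
  the orthogonal projection can be computed on each of these spheres separately:
  \<open>\<Pi>\<phi>(e\<^sup>J\<^sup>t) = A + J B\<close> with \<open>A = \<integral> \<phi>(e\<^sup>I\<^sup>t) d\<sigma>(I)\<close> and \<open>B = - \<integral> I \<phi>(e\<^sup>I\<^sup>t) d\<sigma>(I)\<close>, that is,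
  \<open>\<Pi>\<phi>(e\<^sup>J\<^sup>t) = \<integral> (1 - J I) \<phi>(e\<^sup>I\<^sup>t) d\<sigma>(I)\<close>
  (lemmas \<open>is_slice_proj_slice_average\<close> and \<open>slice_average_kernel\<close>).

  The kernel has modulus \<open>|1 - J I| = |I + J|\<close>. By Archimedes' hat-box theorem
  (\<open>integral_zonal_imag_units\<close>) the inner product of \<open>I\<close> and \<open>J\<close> is uniformly distributed on
  \<open>[-1, 1]\<close>, whence \<open>\<integral> |I + J|\<^sup>q d\<sigma>(I) = 2\<^sup>q \<cdot> 2 / (q + 2)\<close>. Hoelder's inequality on each sphere then
  gives the bound for finite exponents (\<open>slice_proj_norm_le_bound\<close>), and with \<open>q = 1\<close> the upper bound \<open>4/3\<close>
  for \<open>p = \<infinity>\<close>.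

  The constant \<open>4/3\<close> is sharp: at \<open>J = k\<close> and for \<open>t\<close> in \<open>(0, \<pi>)\<close> the function
  \<open>\<phi>(e\<^sup>I\<^sup>t) = (I + k) / |I + k|\<close>, of modulus \<open>1\<close>, aligns all the values of the kernel, so that
  \<open>|A + k B| = \<integral> |I + k| d\<sigma>(I) = 4/3\<close>. Since \<open>|A + J B|\<close> is continuous in \<open>J\<close> and every
  neighbourhood of \<open>k\<close> has positive area, the essential supremum is not smaller
  (\<open>slice_proj_norm_infinity_ge\<close>).

  The equality of the norms for conjugate exponents holds because an orthogonal projection is
  symmetric: the norm of \<open>\<Pi>\<phi>\<close> is determined by pairing it with bounded test functions
  (\<open>Lp_norm_le_of_dual\<close>), and in each pairing \<open>\<Pi>\<close> may be moved to the test function and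
  estimated in the conjugate norm (\<open>slice_proj_norm_conjugate_le\<close>). Finally, the norm for
  \<open>p = 2\<close> is \<open>1\<close> as \<open>\<Pi>\<close> is an orthogonal projection that fixes the constants.
\<close>

section \<open>Archimedes' hat-box theorem\<close>

lemma integral_imag_units_area:
  fixes g :: "quaternion \<Rightarrow> real"
  assumes g: "continuous_on imag_units g"
  shows "(\<integral>I. g I \<partial>imag_units_area) =
    integral (cbox (0, 0) (pi, 2 * pi)) (\<lambda>x. g (spherical_coords x) * sin (fst x)) / (4 * pi)"
proof -
  define d where "d x = indicator (cbox (0, 0) (pi, 2 * pi)) x * (sin (fst x) / (4 * pi))" for x :: "real \<times> real"
  have d_nonneg: "0 \<le> d x" for x
    by (cases x) (auto simp: d_def sin_ge_zero indicator_def)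
  have [measurable]: "d \<in> borel_measurable borel"
    unfolding d_def
    by (intro borel_measurable_times borel_measurable_indicator borel_measurable_continuous_onI continuous_intros) auto
  have d: "spherical_density = (\<lambda>x. ennreal (d x))"
    by (auto simp: fun_eq_iff spherical_density_def d_def indicator_def cbox_Pair_eq cbox_interval
        simp del: cbox_interval[symmetric])
  have gm: "g \<in> borel_measurable (restrict_space borel imag_units)"
    by (rule borel_measurable_continuous_on_restrict [OF g])
  have m: "spherical_coords \<in> lborel \<rightarrow>\<^sub>M restrict_space borel imag_units"
    using measurable_spherical_coords by simp
  have cont: "continuous_on (cbox (0, 0) (pi, 2 * pi)) (\<lambda>x. g (spherical_coords x) * sin (fst x))"
  proof (intro continuous_intros continuous_on_compose2 [OF g])
    show "continuous_on (cbox (0, 0) (pi, 2 * pi)) spherical_coords"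
      unfolding spherical_coords_def case_prod_beta
      by (subst continuous_on_componentwise)
        (auto simp: Basis_quaternion_def inner_quaternion_def intro!: continuous_intros)
  qed (use spherical_coords_in_imag_units in auto)
  have "(\<integral>I. g I \<partial>imag_units_area) = (\<integral>x. g (spherical_coords x) \<partial>density lborel spherical_density)"
    unfolding imag_units_area_def using m gm by (subst integral_distr) auto
  also have "\<dots> = (\<integral>x. d x *\<^sub>R g (spherical_coords x) \<partial>lborel)"
    unfolding d using m gm d_nonneg by (subst integral_density) auto
  also have "\<dots> = (\<integral>x. (indicator (cbox (0, 0) (pi, 2 * pi)) x *\<^sub>R (g (spherical_coords x) * sin (fst x))) / (4 * pi) \<partial>lborel)"
    by (intro Bochner_Integration.integral_cong) (auto simp: d_def)
  also have "\<dots> = (\<integral>x. indicator (cbox (0, 0) (pi, 2 * pi)) x *\<^sub>R (g (spherical_coords x) * sin (fst x)) \<partial>lborel) / (4 * pi)"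
    by simp
  also have "(\<integral>x. indicator (cbox (0, 0) (pi, 2 * pi)) x *\<^sub>R (g (spherical_coords x) * sin (fst x)) \<partial>lborel) =
     integral (cbox (0, 0) (pi, 2 * pi)) (\<lambda>x. g (spherical_coords x) * sin (fst x))"
    using set_borel_integral_eq_integral(2) [of "cbox (0, 0) (pi, 2 * pi)" "\<lambda>x. g (spherical_coords x) * sin (fst x)"]
      borel_integrable_compact [OF compact_cbox cont]
    by (simp add: set_lebesgue_integral_def set_integrable_def)
  finally show ?thesis .
qed

lemma imag_units_spherical_coords:
  assumes "J \<in> imag_units"
  obtains \<alpha> \<beta> where "J = spherical_coords (\<alpha>, \<beta>)"
proof -
  obtain r \<beta> where r: "Im_i J = r * cos \<beta>" "Im_j J = r * sin \<beta>"
    using polar_Ex by blast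
  have J: "Re_quat J = 0" "(Im_i J)\<^sup>2 + (Im_j J)\<^sup>2 + (Im_k J)\<^sup>2 = 1"
    using assms by (auto simp: imag_units_iff)
  have "(Im_i J)\<^sup>2 + (Im_j J)\<^sup>2 = r\<^sup>2 * ((cos \<beta>)\<^sup>2 + (sin \<beta>)\<^sup>2)"
    unfolding r by (simp only: power_mult_distrib distrib_left)
  with J have "(Im_k J)\<^sup>2 + r\<^sup>2 = 1"
    by simp
  then obtain \<alpha> where "Im_k J = cos \<alpha>" "r = sin \<alpha>"
    using sincos_total_2pi by metis
  with r J have "J = spherical_coords (\<alpha>, \<beta>)"
    by (simp add: spherical_coords_def quaternion_eq_iff)
  then show ?thesis by (rule that)
qed

lemma inner_spherical_coords:
  "spherical_coords (\<theta>, \<phi>) \<bullet> spherical_coords (\<alpha>, \<beta>) =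
     sin \<alpha> * sin \<theta> * cos (\<phi> - \<beta>) + cos \<alpha> * cos \<theta>"
  by (simp add: spherical_coords_def inner_quaternion_def cos_diff algebra_simps)

text \<open>
  Moving the pole \<open>J\<close> along a meridian rotates the sphere, and a rotation field is divergence free.
  In spherical coordinates this says that the derivative in \<open>\<alpha>\<close> of the integrand is
  \<open>- \<partial>\<^sub>\<theta> (sin \<theta> cos (\<phi> - \<beta>) h(u)) + \<partial>\<^sub>\<phi> (cos \<theta> sin (\<phi> - \<beta>) h(u))\<close>. The first term integrates to \<open>0\<close>
  because \<open>sin \<theta>\<close> vanishes at both poles, the second because it is the derivative of a periodic function of \<open>\<phi>\<close>.
\<close>

lemma zonal_integral_derivative_zero:
  fixes h h' :: "real \<Rightarrow> real" and \<alpha> \<beta> :: real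
  assumes h: "\<And>c. (h has_real_derivative h' c) (at c)" and h': "continuous_on UNIV h'"
  defines "u \<equiv> \<lambda>\<alpha> \<theta> \<phi>. sin \<alpha> * sin \<theta> * cos (\<phi> - \<beta>) + cos \<alpha> * cos \<theta>"
  shows "((\<lambda>\<alpha>. integral (cbox (0, 0) (pi, 2 * pi)) (\<lambda>x. h (u \<alpha> (fst x) (snd x)) * sin (fst x)))
     has_real_derivative 0) (at \<alpha>)"
proof -
  have hc: "continuous_on UNIV h"
    using h by (meson DERIV_isCont continuous_at_imp_continuous_on)
  note [continuous_intros] = continuous_on_compose2 [OF hc] continuous_on_compose2 [OF h']
  define D where "D \<alpha> x = h' (u \<alpha> (fst x) (snd x)) *
      (cos \<alpha> * sin (fst x) * cos (snd x - \<beta>) - sin \<alpha> * cos (fst x)) * sin (fst x)" for \<alpha> and x :: "real \<times> real"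
  \<comment> \<open>\<open>g1\<close> and \<open>g2\<close> are the two exact derivatives, in \<open>\<theta>\<close> and in \<open>\<phi>\<close>\<close>
  define g1 where "g1 \<theta> \<phi> = - (cos \<theta> * cos (\<phi> - \<beta>) * h (u \<alpha> \<theta> \<phi>) +
     sin \<theta> * cos (\<phi> - \<beta>) * (h' (u \<alpha> \<theta> \<phi>) * (sin \<alpha> * cos \<theta> * cos (\<phi> - \<beta>) - cos \<alpha> * sin \<theta>)))" for \<theta> \<phi>
  define g2 where "g2 \<theta> \<phi> = cos \<theta> * cos (\<phi> - \<beta>) * h (u \<alpha> \<theta> \<phi>) -
     cos \<theta> * sin (\<phi> - \<beta>) * (h' (u \<alpha> \<theta> \<phi>) * (sin \<alpha> * sin \<theta> * sin (\<phi> - \<beta>)))" for \<theta> \<phi>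
  have deriv: "((\<lambda>\<alpha>. integral (cbox (0, 0) (pi, 2 * pi)) (\<lambda>x. h (u \<alpha> (fst x) (snd x)) * sin (fst x)))
     has_real_derivative integral (cbox (0, 0) (pi, 2 * pi)) (D \<alpha>)) (at \<alpha> within UNIV)"
  proof (rule leibniz_rule_field_derivative)
    fix a :: real and x :: "real \<times> real"
    show "((\<lambda>\<alpha>. h (u \<alpha> (fst x) (snd x)) * sin (fst x)) has_real_derivative D a x) (at a within UNIV)"
      unfolding D_def u_def by (auto intro!: derivative_eq_intros DERIV_chain2 [OF h] simp: algebra_simps)
    show "(\<lambda>x. h (u a (fst x) (snd x)) * sin (fst x)) integrable_on cbox (0, 0) (pi, 2 * pi)"
      unfolding u_def by (intro integrable_continuous continuous_intros) auto
  next
    show "continuous_on (UNIV \<times> cbox (0, 0) (pi, 2 * pi)) (\<lambda>(x, y). D x y)"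
      unfolding D_def u_def case_prod_beta by (intro continuous_intros) auto
  qed auto
  have D_eq: "D \<alpha> x = g1 (fst x) (snd x) + g2 (fst x) (snd x)" for x
    using sin_cos_squared_add [of "snd x - \<beta>"] unfolding D_def g1_def g2_def by algebra
  have c1: "continuous_on S (\<lambda>(x, y). g1 x y)" and c2: "continuous_on S (\<lambda>(x, y). g2 x y)" for S
    unfolding g1_def g2_def u_def case_prod_beta by (intro continuous_intros; simp)+
  have i1: "integral (cbox 0 pi) (\<lambda>\<theta>. g1 \<theta> \<phi>) = 0" for \<phi>
  proof -
    have "((\<lambda>\<theta>. g1 \<theta> \<phi>) has_integral
        (- (sin pi * cos (\<phi> - \<beta>) * h (u \<alpha> pi \<phi>))) - (- (sin 0 * cos (\<phi> - \<beta>) * h (u \<alpha> 0 \<phi>)))) {0..pi}"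
    proof (rule fundamental_theorem_of_calculus)
      fix \<theta>
      have "((\<lambda>\<theta>. - (sin \<theta> * cos (\<phi> - \<beta>) * h (u \<alpha> \<theta> \<phi>))) has_real_derivative g1 \<theta> \<phi>) (at \<theta> within {0..pi})"
        unfolding g1_def u_def
        by (rule derivative_eq_intros DERIV_chain2 [OF h] refl)+ (simp add: algebra_simps)
      then show "((\<lambda>\<theta>. - (sin \<theta> * cos (\<phi> - \<beta>) * h (u \<alpha> \<theta> \<phi>))) has_vector_derivative g1 \<theta> \<phi>) (at \<theta> within {0..pi})"
        by (simp add: has_real_derivative_iff_has_vector_derivative)
    qed simp
    then show ?thesis by (simp add: integral_unique cbox_interval)
  qed
  have i2: "integral (cbox 0 (2 * pi)) (g2 \<theta>) = 0" for \<theta>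
  proof -
    have "(g2 \<theta> has_integral
        (cos \<theta> * sin (2 * pi - \<beta>) * h (u \<alpha> \<theta> (2 * pi))) - (cos \<theta> * sin (0 - \<beta>) * h (u \<alpha> \<theta> 0))) {0..2 * pi}"
    proof (rule fundamental_theorem_of_calculus)
      fix \<phi>
      have "((\<lambda>\<phi>. cos \<theta> * sin (\<phi> - \<beta>) * h (u \<alpha> \<theta> \<phi>)) has_real_derivative g2 \<theta> \<phi>) (at \<phi> within {0..2 * pi})"
        unfolding g2_def u_def
        by (rule derivative_eq_intros DERIV_chain2 [OF h] refl)+ (simp add: algebra_simps)
      then show "((\<lambda>\<phi>. cos \<theta> * sin (\<phi> - \<beta>) * h (u \<alpha> \<theta> \<phi>)) has_vector_derivative g2 \<theta> \<phi>) (at \<phi> within {0..2 * pi})"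
        by (simp add: has_real_derivative_iff_has_vector_derivative)
    qed simp
    moreover have "u \<alpha> \<theta> (2 * pi) = u \<alpha> \<theta> 0" "sin (2 * pi - \<beta>) = sin (0 - \<beta>)"
      by (simp_all add: u_def cos_diff sin_diff)
    ultimately show ?thesis by (simp add: integral_unique cbox_interval)
  qed
  have "integral (cbox (0, 0) (pi, 2 * pi)) (D \<alpha>) =
      integral (cbox (0, 0) (pi, 2 * pi)) (\<lambda>(x, y). g1 x y) + integral (cbox (0, 0) (pi, 2 * pi)) (\<lambda>(x, y). g2 x y)"
    by (subst integral_add [symmetric]) (auto intro!: integrable_continuous c1 c2 integral_cong simp: D_eq case_prod_beta)
  also have "integral (cbox (0, 0) (pi, 2 * pi)) (\<lambda>(x, y). g2 x y) = 0"
    using integral_prod_continuous [OF c2, of 0 0 pi "2 * pi"] i2 by simp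
  also have "integral (cbox (0, 0) (pi, 2 * pi)) (\<lambda>(x, y). g1 x y) = 0"
    using integral_prod_continuous [OF c1, of 0 0 pi "2 * pi"] integral_swap_continuous [OF c1, of 0 pi 0 "2 * pi"] i1 by simp
  finally show ?thesis using deriv by simp
qed

text \<open>
  By the previous lemma the pole may be moved to \<open>k\<close>, where the integrand depends on \<open>\<theta>\<close> only and
  the substitution \<open>c = cos \<theta>\<close> applies.
\<close>

lemma integral_zonal_imag_units_C1:
  fixes h h' :: "real \<Rightarrow> real"
  assumes h: "\<And>c. (h has_real_derivative h' c) (at c)" and h': "continuous_on UNIV h'"
    and J: "J \<in> imag_units"
  shows "(\<integral>I. h (I \<bullet> J) \<partial>imag_units_area) = integral {-1..1} h / 2"
proof -
  obtain \<alpha> \<beta> where J: "J = spherical_coords (\<alpha>, \<beta>)"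
    using imag_units_spherical_coords [OF J] by blast
  have hc: "continuous_on UNIV h"
    using h by (meson DERIV_isCont continuous_at_imp_continuous_on)
  define F where "F \<alpha> = integral (cbox (0, 0) (pi, 2 * pi))
     (\<lambda>x. h (sin \<alpha> * sin (fst x) * cos (snd x - \<beta>) + cos \<alpha> * cos (fst x)) * sin (fst x))" for \<alpha>
  have "F \<alpha> = F 0"
    using DERIV_isconst_all [of F \<alpha> 0] zonal_integral_derivative_zero [OF h h'] unfolding F_def by blast
  have "(\<integral>I. h (I \<bullet> J) \<partial>imag_units_area) =
      integral (cbox (0, 0) (pi, 2 * pi)) (\<lambda>x. h (spherical_coords x \<bullet> J) * sin (fst x)) / (4 * pi)"
    by (intro integral_imag_units_area continuous_on_compose2 [OF hc] continuous_intros) auto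
  also have "integral (cbox (0, 0) (pi, 2 * pi)) (\<lambda>x. h (spherical_coords x \<bullet> J) * sin (fst x)) = F \<alpha>"
    unfolding F_def J inner_spherical_coords [symmetric] by simp
  also have "F \<alpha> = F 0" by fact
  also have "F 0 = integral (cbox 0 pi) (\<lambda>\<theta>. integral (cbox 0 (2 * pi)) (\<lambda>\<phi>. h (cos \<theta>) * sin \<theta>))"
    unfolding F_def
    by (subst integral_prod_continuous) (auto intro!: continuous_intros continuous_on_compose2 [OF hc])
  also have "\<dots> = integral {0..pi} (\<lambda>\<theta>. (2 * pi) * (h (cos \<theta>) * sin \<theta>))"
    unfolding cbox_interval by (rule integral_cong) simp
  also have "\<dots> = 2 * pi * integral {0..pi} (\<lambda>\<theta>. h (cos \<theta>) * sin \<theta>)"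
    by (rule integral_mult_right)
  also have "integral {0..pi} (\<lambda>\<theta>. h (cos \<theta>) * sin \<theta>) = integral {-1..1} h"
  proof -
    have "((\<lambda>\<theta>. (- sin \<theta>) *\<^sub>R h (cos \<theta>)) has_integral (integral {cos 0..cos pi} h - integral {cos pi..cos 0} h)) {0..pi}"
      by (rule has_integral_substitution_general [where s = "{}" and c = "-1" and d = 1])
        (auto intro!: continuous_on_subset [OF hc] derivative_eq_intros continuous_intros)
    then have "((\<lambda>\<theta>. - ((- sin \<theta>) *\<^sub>R h (cos \<theta>))) has_integral - (0 - integral {-1..1} h)) {0..pi}"
      by (intro has_integral_neg) simp
    then show ?thesis by (simp add: integral_unique mult.commute)
  qed
  finally show ?thesis by simp
qed

lemma inner_imag_units_in_Icc:
  assumes "I \<in> imag_units" "J \<in> imag_units"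
  shows "I \<bullet> J \<in> {-1..1}"
proof -
  have "norm I = 1" "norm J = 1"
    using assms by (auto simp: imag_units_iff norm_quaternion_def)
  then show ?thesis
    using Cauchy_Schwarz_ineq2 [of I J] by auto
qed

text \<open>
  Archimedes' hat-box theorem: the projection of the normalized area onto a diameter is uniform.
  Polynomials are differentiable, and they are uniformly dense in the continuous functions on \<open>[-1, 1]\<close>.
\<close>

theorem integral_zonal_imag_units:
  fixes h :: "real \<Rightarrow> real"
  assumes h: "continuous_on {-1..1} h" and J: "J \<in> imag_units"
  shows "(\<integral>I. h (I \<bullet> J) \<partial>imag_units_area) = integral {-1..1} h / 2"
proof -
  interpret prob_space imag_units_area by (rule prob_space_imag_units_area)
  let ?L = "\<integral>I. h (I \<bullet> J) \<partial>imag_units_area" and ?R = "integral {-1..1} h / 2"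
  have int: "integrable imag_units_area (\<lambda>I. g (I \<bullet> J))" if g: "continuous_on {-1..1} g" for g :: "real \<Rightarrow> real"
  proof -
    obtain B where B: "\<And>c. c \<in> {-1..1} \<Longrightarrow> norm (g c) \<le> B"
      using compact_imp_bounded [OF compact_continuous_image [OF g compact_Icc]]
      unfolding bounded_iff by blast
    have "continuous_on imag_units (\<lambda>I. g (I \<bullet> J))"
      by (intro continuous_on_compose2 [OF g] continuous_intros) (use inner_imag_units_in_Icc [OF _ J] in auto)
    then have "(\<lambda>I. g (I \<bullet> J)) \<in> borel_measurable (restrict_space borel imag_units)"
      by (rule borel_measurable_continuous_on_restrict)
    then have m: "(\<lambda>I. g (I \<bullet> J)) \<in> borel_measurable imag_units_area"
      by (simp add: measurable_cong_sets [OF sets_imag_units_area refl])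
    show ?thesis
      by (rule integrable_const_bound [of _ B]) (use m B inner_imag_units_in_Icc [OF _ J] in auto)
  qed
  have "\<bar>?L - ?R\<bar> \<le> e" if e: "e > 0" for e
  proof -
    obtain p where p: "real_polynomial_function p" "\<And>c. c \<in> {-1..1} \<Longrightarrow> \<bar>h c - p c\<bar> < e / 2"
      using Stone_Weierstrass_real_polynomial_function [OF compact_Icc h, of "e / 2"] e by auto
    obtain p' where p': "real_polynomial_function p'" "\<And>c. (p has_real_derivative p' c) (at c)"
      using has_real_derivative_polynomial_function [OF p(1)] by auto
    have pc: "continuous_on S p" and p'c: "continuous_on S p'" for S
      using p(1) p'(1) continuous_on_polymonial_function real_polynomial_function_eq by auto
    have "\<bar>?L - (\<integral>I. p (I \<bullet> J) \<partial>imag_units_area)\<bar> = \<bar>\<integral>I. h (I \<bullet> J) - p (I \<bullet> J) \<partial>imag_units_area\<bar>"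
      by (subst Bochner_Integration.integral_diff) (auto intro!: int h pc)
    also have "\<dots> \<le> (\<integral>I. \<bar>h (I \<bullet> J) - p (I \<bullet> J)\<bar> \<partial>imag_units_area)"
      by (rule integral_abs_bound)
    also have "\<dots> \<le> (\<integral>I. e / 2 \<partial>imag_units_area)"
      by (intro integral_mono integrable_abs Bochner_Integration.integrable_diff int h pc)
        (use p(2) inner_imag_units_in_Icc [OF _ J] in \<open>auto intro: less_imp_le\<close>)
    finally have 1: "\<bar>?L - (\<integral>I. p (I \<bullet> J) \<partial>imag_units_area)\<bar> \<le> e / 2"
      using prob_space by simp
    have "\<bar>integral {-1..1} h - integral {-1..1} p\<bar> = norm (integral {-1..1} (\<lambda>c. h c - p c))"
      by (subst integral_diff) (auto intro!: integrable_continuous_interval h pc)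
    also have "\<dots> \<le> (e / 2) * (1 - (-1))"
      by (rule integral_bound) (use p(2) in \<open>auto intro!: continuous_intros h pc intro: less_imp_le\<close>)
    finally have 2: "\<bar>integral {-1..1} h - integral {-1..1} p\<bar> \<le> e"
      by simp
    show ?thesis
      using 1 2 integral_zonal_imag_units_C1 [OF p'(2) p'c J] by linarith
  qed
  then show ?thesis
    using field_le_epsilon [of "\<bar>?L - ?R\<bar>" 0] by simp
qed

section \<open>Antipodal symmetry and polar coordinates on the unit sphere\<close>

lemma nn_integral_shift_period:
  fixes g :: "real \<Rightarrow> ennreal"
  assumes [measurable]: "g \<in> borel_measurable borel" and per: "\<And>x. g (x + 2 * pi) = g x"
  shows "(\<integral>\<^sup>+x. g (x + pi) * indicator {0..2 * pi} x \<partial>lborel) = (\<integral>\<^sup>+x. g x * indicator {0..2 * pi} x \<partial>lborel)"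
proof -
  have shift: "(\<integral>\<^sup>+x. g (x + c) * indicator {a..<b} x \<partial>lborel) = (\<integral>\<^sup>+x. g x * indicator {a + c..<b + c} x \<partial>lborel)"
    for a b c :: real
    by (subst nn_integral_real_affine [of "\<lambda>x. g x * indicator {a + c..<b + c} x" 1 c])
      (auto intro!: nn_integral_cong simp: indicator_def add.commute)
  have closed: "(\<integral>\<^sup>+x. f x * indicator {0..2 * pi} x \<partial>lborel) = (\<integral>\<^sup>+x. f x * indicator {0..<2 * pi} x \<partial>lborel)"
    for f :: "real \<Rightarrow> ennreal"
    by (intro nn_integral_cong_AE eventually_mono [OF AE_lborel_singleton [of "2 * pi"]])
      (auto simp: indicator_def)
  have split: "(\<integral>\<^sup>+x. g x * indicator {a..<c} x \<partial>lborel) =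
     (\<integral>\<^sup>+x. g x * indicator {a..<b} x \<partial>lborel) + (\<integral>\<^sup>+x. g x * indicator {b..<c} x \<partial>lborel)"
    if "a \<le> b" "b \<le> c" for a b c :: real
    by (subst nn_integral_add [symmetric]) (use that in \<open>auto intro!: nn_integral_cong simp: indicator_def\<close>)
  have "(\<integral>\<^sup>+x. g (x + pi) * indicator {0..2 * pi} x \<partial>lborel) = (\<integral>\<^sup>+x. g x * indicator {pi..<3 * pi} x \<partial>lborel)"
    unfolding closed shift by simp
  also have "\<dots> = (\<integral>\<^sup>+x. g x * indicator {pi..<2 * pi} x \<partial>lborel) + (\<integral>\<^sup>+x. g x * indicator {2 * pi..<3 * pi} x \<partial>lborel)"
    by (rule split) auto
  also have "(\<integral>\<^sup>+x. g x * indicator {2 * pi..<3 * pi} x \<partial>lborel) = (\<integral>\<^sup>+x. g x * indicator {0..<pi} x \<partial>lborel)"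
    using shift [of "2 * pi" 0 pi] by (simp add: per)
  also have "(\<integral>\<^sup>+x. g x * indicator {pi..<2 * pi} x \<partial>lborel) + \<dots> = (\<integral>\<^sup>+x. g x * indicator {0..<2 * pi} x \<partial>lborel)"
    using split [of 0 pi "2 * pi"] by (simp add: add.commute)
  finally show ?thesis unfolding closed .
qed

lemma measurable_imag_units_area_iff:
  "borel_measurable imag_units_area = borel_measurable (restrict_space borel imag_units)"
  by (rule measurable_cong_sets) simp_all

lemma measurable_bdry_measure_iff:
  "borel_measurable bdry_measure = borel_measurable (restrict_space borel (sphere 0 1))"
  by (rule measurable_cong_sets) simp_all

lemma nn_integral_imag_units_area:
  assumes f: "f \<in> borel_measurable imag_units_area"
  shows "(\<integral>\<^sup>+I. f I \<partial>imag_units_area) =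
    (\<integral>\<^sup>+\<theta>. (\<integral>\<^sup>+\<phi>. f (spherical_coords (\<theta>, \<phi>)) * indicator {0..2 * pi} \<phi> \<partial>lborel) *
       (ennreal (sin \<theta> / (4 * pi)) * indicator {0..pi} \<theta>) \<partial>lborel)"
proof -
  have fm: "f \<in> borel_measurable (restrict_space borel imag_units)"
    using f by (simp add: measurable_imag_units_area_iff)
  have m: "spherical_coords \<in> lborel \<rightarrow>\<^sub>M restrict_space borel imag_units"
    using measurable_spherical_coords by simp
  have fs [measurable]: "(\<lambda>x. f (spherical_coords x)) \<in> borel_measurable borel"
    using measurable_compose [OF m fm] by simp
  have fs2: "(\<lambda>x. f (spherical_coords x)) \<in> borel_measurable (borel \<Otimes>\<^sub>M borel)"
    using fs by (simp add: borel_prod)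
  have "(\<integral>\<^sup>+I. f I \<partial>imag_units_area) = (\<integral>\<^sup>+x. f (spherical_coords x) \<partial>density lborel spherical_density)"
    unfolding imag_units_area_def using m fm by (subst nn_integral_distr) auto
  also have "\<dots> = (\<integral>\<^sup>+x. spherical_density x * f (spherical_coords x) \<partial>lborel)"
    by (subst nn_integral_density) auto
  also have "\<dots> = (\<integral>\<^sup>+\<theta>. \<integral>\<^sup>+\<phi>. spherical_density (\<theta>, \<phi>) * f (spherical_coords (\<theta>, \<phi>)) \<partial>lborel \<partial>lborel)"
    unfolding lborel_prod [symmetric]
    by (rule lborel.nn_integral_fst [symmetric]) (simp add: lborel_prod)
  also have "\<dots> = (\<integral>\<^sup>+\<theta>. \<integral>\<^sup>+\<phi>. (f (spherical_coords (\<theta>, \<phi>)) * indicator {0..2 * pi} \<phi>) *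
       (ennreal (sin \<theta> / (4 * pi)) * indicator {0..pi} \<theta>) \<partial>lborel \<partial>lborel)"
    by (intro nn_integral_cong) (simp add: spherical_density_eq mult_ac)
  also have "\<dots> = (\<integral>\<^sup>+\<theta>. (\<integral>\<^sup>+\<phi>. f (spherical_coords (\<theta>, \<phi>)) * indicator {0..2 * pi} \<phi> \<partial>lborel) *
       (ennreal (sin \<theta> / (4 * pi)) * indicator {0..pi} \<theta>) \<partial>lborel)"
    by (intro nn_integral_cong nn_integral_multc) (use fs2 in measurable)
  finally show ?thesis .
qed

lemma uminus_imag_units_iff [simp]: "- I \<in> imag_units \<longleftrightarrow> I \<in> imag_units"
  by (simp add: imag_units_iff)

lemma measurable_uminus_imag_units [measurable]:
  "uminus \<in> imag_units_area \<rightarrow>\<^sub>M imag_units_area"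
proof -
  have "uminus \<in> restrict_space borel imag_units \<rightarrow>\<^sub>M restrict_space borel imag_units"
    by (intro measurable_restrict_space2 measurable_restrict_space1) (auto simp: space_restrict_space)
  then show ?thesis
    by (subst measurable_cong_sets [OF sets_imag_units_area sets_imag_units_area])
qed

text \<open>
  In spherical coordinates the antipode of \<open>(\<theta>, \<phi>)\<close> is \<open>(\<pi> - \<theta>, \<phi> + \<pi>)\<close>, and both substitutions
  preserve the density.
\<close>

lemma nn_integral_imag_units_area_uminus:
  assumes f [measurable]: "f \<in> borel_measurable imag_units_area"
  shows "(\<integral>\<^sup>+I. f (- I) \<partial>imag_units_area) = (\<integral>\<^sup>+I. f I \<partial>imag_units_area)"
proof -
  have "f \<in> borel_measurable (restrict_space borel imag_units)"
    using f by (simp add: measurable_imag_units_area_iff)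
  from measurable_compose [OF measurable_spherical_coords this]
  have fs [measurable]: "(\<lambda>x. f (spherical_coords x)) \<in> borel_measurable (borel \<Otimes>\<^sub>M borel)"
    by (simp add: borel_prod)
  define F where "F \<theta> = (\<integral>\<^sup>+\<phi>. f (spherical_coords (\<theta>, \<phi>)) * indicator {0..2 * pi} \<phi> \<partial>lborel)" for \<theta>
  have [measurable]: "F \<in> borel_measurable borel"
    unfolding F_def using fs by measurable
  have "- spherical_coords (\<theta>, \<phi>) = spherical_coords (pi - \<theta>, \<phi> + pi)" for \<theta> \<phi>
    by (simp add: spherical_coords_def quaternion_eq_iff)
  then have "(\<integral>\<^sup>+\<phi>. f (- spherical_coords (\<theta>, \<phi>)) * indicator {0..2 * pi} \<phi> \<partial>lborel) =
      (\<integral>\<^sup>+\<phi>. f (spherical_coords (pi - \<theta>, \<phi> + pi)) * indicator {0..2 * pi} \<phi> \<partial>lborel)" for \<theta>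
    by simp
  also have "\<dots> \<theta> = F (pi - \<theta>)" for \<theta>
    unfolding F_def
    by (rule nn_integral_shift_period [where g = "\<lambda>\<phi>. f (spherical_coords (pi - \<theta>, \<phi>))"])
      (use fs in measurable, simp add: spherical_coords_def)
  finally have eq: "(\<integral>\<^sup>+\<phi>. f (- spherical_coords (\<theta>, \<phi>)) * indicator {0..2 * pi} \<phi> \<partial>lborel) = F (pi - \<theta>)" for \<theta> .
  have "(\<integral>\<^sup>+I. f (- I) \<partial>imag_units_area) =
     (\<integral>\<^sup>+\<theta>. F (pi - \<theta>) * (ennreal (sin \<theta> / (4 * pi)) * indicator {0..pi} \<theta>) \<partial>lborel)"
    by (subst nn_integral_imag_units_area) (simp_all add: eq)
  also have "\<dots> = (\<integral>\<^sup>+\<theta>. F \<theta> * (ennreal (sin \<theta> / (4 * pi)) * indicator {0..pi} \<theta>) \<partial>lborel)"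
    by (subst nn_integral_real_affine [of "\<lambda>\<theta>. F \<theta> * (ennreal (sin \<theta> / (4 * pi)) * indicator {0..pi} \<theta>)" "- 1" pi])
      (auto intro!: nn_integral_cong simp: indicator_def)
  also have "\<dots> = (\<integral>\<^sup>+I. f I \<partial>imag_units_area)"
    by (subst nn_integral_imag_units_area [OF f]) (simp add: F_def)
  finally show ?thesis .
qed

lemma distr_imag_units_area_uminus: "distr imag_units_area imag_units_area uminus = imag_units_area"
proof (rule measure_eqI)
  fix A assume "A \<in> sets (distr imag_units_area imag_units_area uminus)"
  then have A [measurable]: "A \<in> sets imag_units_area" by simp
  have "emeasure (distr imag_units_area imag_units_area uminus) A =
      (\<integral>\<^sup>+I. indicator A I \<partial>distr imag_units_area imag_units_area uminus)"
    using A by (intro nn_integral_indicator [symmetric]) simp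
  also have "\<dots> = (\<integral>\<^sup>+I. indicator A (- I) \<partial>imag_units_area)"
    by (subst nn_integral_distr) auto
  also have "\<dots> = emeasure imag_units_area A"
    using A by (subst nn_integral_imag_units_area_uminus) simp_all
  finally show "emeasure (distr imag_units_area imag_units_area uminus) A = emeasure imag_units_area A" .
qed simp

text \<open>
  Since \<open>e\<^sup>I\<^sup>t\<close> is unchanged when \<open>(I, t)\<close> becomes \<open>(- I, 2\<pi> - t)\<close>, the angles in \<open>[0, \<pi>]\<close> already
  cover the unit sphere. On the interior of this interval both \<open>t\<close> and \<open>I\<close> are determined by the point,
  so that functions on the unit sphere are functions of \<open>(t, I)\<close> without any compatibility condition.
\<close>

abbreviation half_circle :: "real measure" where
  "half_circle \<equiv> uniform_measure lborel {0..pi}"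

lemma measurable_slice_point_half:
  "(\<lambda>(t, I). slice_point I t) \<in>
     (half_circle \<Otimes>\<^sub>M imag_units_area) \<rightarrow>\<^sub>M restrict_space borel (sphere 0 1)"
proof -
  have eq: "sets (half_circle \<Otimes>\<^sub>M imag_units_area) = sets (borel \<Otimes>\<^sub>M restrict_space borel imag_units)"
    by (rule sets_pair_measure_cong) simp_all
  show ?thesis
    by (simp only: measurable_cong_sets [OF eq refl] measurable_slice_point)
qed

lemma measurable_compose_slice_point [measurable (raw)]:
  assumes "f \<in> bdry_measure \<rightarrow>\<^sub>M K"
  shows "(\<lambda>x. f (slice_point (snd x) (fst x))) \<in> (half_circle \<Otimes>\<^sub>M imag_units_area) \<rightarrow>\<^sub>M K"
proof -
  have "f \<in> restrict_space borel (sphere 0 1) \<rightarrow>\<^sub>M K"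
    using assms by (simp only: measurable_cong_sets [OF sets_bdry_measure refl])
  from measurable_compose [OF measurable_slice_point_half this] show ?thesis
    by (simp only: case_prod_beta)
qed

lemma prob_space_half_circle: "prob_space half_circle"
  by (rule prob_space_uniform_measure) simp_all

lemma slice_point_2pi_minus: "slice_point I (2 * pi - t) = slice_point (- I) t"
  by (simp add: slice_point_def)

text \<open>
  The lower half of the circle contributes as much as the upper one, by antipodal symmetry of the
  area measure; hence averaging over \<open>[0, 2\<pi>]\<close> is the same as averaging over \<open>[0, \<pi>]\<close>.
\<close>

lemma bdry_measure_half:
  "bdry_measure = distr (half_circle \<Otimes>\<^sub>M imag_units_area) (restrict_space borel (sphere 0 1))
     (\<lambda>(t, I). slice_point I t)"
proof (rule measure_eqI)
  interpret S: prob_space imag_units_area by (rule prob_space_imag_units_area)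
  fix A assume "A \<in> sets bdry_measure"
  then have A: "A \<in> sets (restrict_space borel (sphere 0 1))" by simp
  define g :: "quaternion \<Rightarrow> ennreal" where "g = indicator A"
  have g: "g \<in> borel_measurable bdry_measure" "g \<in> borel_measurable (restrict_space borel (sphere 0 1))"
    using A by (auto simp: g_def measurable_bdry_measure_iff)
  note m = measurable_slice_point_half
  note gm = measurable_compose_slice_point [OF g(1)]
  define G where "G t = (\<integral>\<^sup>+ I. g (slice_point I t) \<partial>imag_units_area)" for t
  have "G \<in> borel_measurable half_circle"
    using S.borel_measurable_nn_integral_fst [OF gm] by (simp only: fst_conv snd_conv G_def [abs_def])
  then have Gm [measurable]: "G \<in> borel_measurable borel"
    using measurable_cong_sets [of half_circle borel "borel :: ennreal measure" borel] by simp
  have G2: "G (2 * pi - t) = G t" for t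
  proof -
    have "(\<lambda>I. (t, I)) \<in> imag_units_area \<rightarrow>\<^sub>M half_circle \<Otimes>\<^sub>M imag_units_area"
      by simp
    from measurable_compose [OF this gm]
    have "(\<lambda>I. g (slice_point I t)) \<in> borel_measurable imag_units_area" by simp
    from nn_integral_imag_units_area_uminus [OF this] show ?thesis
      by (simp add: G_def slice_point_2pi_minus)
  qed
  have upper: "(\<integral>\<^sup>+t. G t * indicator {pi<..2 * pi} t \<partial>lborel) = (\<integral>\<^sup>+t. G t * indicator {0..pi} t \<partial>lborel)"
  proof -
    have "(\<integral>\<^sup>+t. G t * indicator {pi<..2 * pi} t \<partial>lborel) = (\<integral>\<^sup>+t. G t * indicator {0..<pi} t \<partial>lborel)"
      by (subst nn_integral_real_affine [of "\<lambda>t. G t * indicator {pi<..2 * pi} t" "- 1" "2 * pi"])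
        (auto intro!: nn_integral_cong simp: G2 indicator_def)
    also have "\<dots> = (\<integral>\<^sup>+t. G t * indicator {0..pi} t \<partial>lborel)"
      by (intro nn_integral_cong_AE eventually_mono [OF AE_lborel_singleton [of "pi"]])
        (auto simp: indicator_def)
    finally show ?thesis .
  qed
  have "(\<integral>\<^sup>+t. G t * indicator {0..2 * pi} t \<partial>lborel) =
     (\<integral>\<^sup>+t. G t * indicator {0..pi} t + G t * indicator {pi<..2 * pi} t \<partial>lborel)"
    by (intro nn_integral_cong) (auto simp: indicator_def)
  also have "\<dots> = (\<integral>\<^sup>+t. G t * indicator {0..pi} t \<partial>lborel) + (\<integral>\<^sup>+t. G t * indicator {pi<..2 * pi} t \<partial>lborel)"
    by (rule nn_integral_add) auto
  finally have G3: "(\<integral>\<^sup>+t. G t * indicator {0..2 * pi} t \<partial>lborel) = 2 * (\<integral>\<^sup>+t. G t * indicator {0..pi} t \<partial>lborel)"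
    unfolding upper by (rule trans) (rule mult_2 [symmetric])
  have "2 * ennreal (inverse (2 * pi)) = ennreal (inverse pi)"
    by (subst ennreal_numeral [symmetric], subst ennreal_mult [symmetric]) auto
  then have two: "2 * X / ennreal (2 * pi) = X / ennreal pi" for X
    unfolding divide_ennreal_def by (simp add: inverse_ennreal) (metis mult.commute mult.assoc)
  have "emeasure bdry_measure A = (\<integral>\<^sup>+x. g x \<partial>bdry_measure)"
    using A by (simp add: g_def)
  also have "\<dots> = 2 * (\<integral>\<^sup>+t. G t * indicator {0..pi} t \<partial>lborel) / ennreal (2 * pi)"
    unfolding nn_integral_bdry_measure [OF g(1)] G3 [symmetric] by (simp add: G_def)
  also have "\<dots> = (\<integral>\<^sup>+t. G t * indicator {0..pi} t \<partial>lborel) / ennreal pi"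
    by (simp only: two)
  also have "\<dots> = (\<integral>\<^sup>+t. G t \<partial>half_circle)"
    by (subst nn_integral_uniform_measure) auto
  also have "\<dots> = (\<integral>\<^sup>+x. g (slice_point (snd x) (fst x)) \<partial>(half_circle \<Otimes>\<^sub>M imag_units_area))"
    unfolding G_def using S.nn_integral_fst [OF gm] by (simp only: fst_conv snd_conv)
  also have "\<dots> = (\<integral>\<^sup>+x. g x \<partial>distr (half_circle \<Otimes>\<^sub>M imag_units_area) (restrict_space borel (sphere 0 1)) (\<lambda>(t, I). slice_point I t))"
    using nn_integral_distr [OF m, of g] g(2) by (simp only: case_prod_beta measurable_distr_eq1)
  also have "\<dots> = emeasure (distr (half_circle \<Otimes>\<^sub>M imag_units_area) (restrict_space borel (sphere 0 1)) (\<lambda>(t, I). slice_point I t)) A"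
    using A by (simp add: g_def)
  finally show "emeasure bdry_measure A = \<dots>" .
qed simp

lemma pair_sigma_finite_half_circle: "pair_sigma_finite half_circle imag_units_area"
  by (intro pair_sigma_finite.intro prob_space_imp_sigma_finite prob_space_half_circle prob_space_imag_units_area)

lemma nn_integral_bdry_measure_half:
  assumes g: "g \<in> borel_measurable bdry_measure"
  shows "(\<integral>\<^sup>+x. g x \<partial>bdry_measure) = (\<integral>\<^sup>+t. \<integral>\<^sup>+I. g (slice_point I t) \<partial>imag_units_area \<partial>half_circle)"
proof -
  interpret pair_sigma_finite half_circle imag_units_area by (rule pair_sigma_finite_half_circle)
  have "(\<integral>\<^sup>+x. g x \<partial>bdry_measure) = (\<integral>\<^sup>+x. g (slice_point (snd x) (fst x)) \<partial>(half_circle \<Otimes>\<^sub>M imag_units_area))"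
    using nn_integral_distr [OF measurable_slice_point_half, of g] g
    unfolding bdry_measure_half [symmetric] by (simp only: case_prod_beta)
  then show ?thesis
    using M2.nn_integral_fst [OF measurable_compose_slice_point [OF g]] by (simp only: fst_conv snd_conv)
qed

lemma AE_bdry_measureD:
  assumes "AE x in bdry_measure. P x"
  shows "AE t in half_circle. AE I in imag_units_area. P (slice_point I t)"
proof -
  interpret pair_sigma_finite half_circle imag_units_area by (rule pair_sigma_finite_half_circle)
  have "AE x in half_circle \<Otimes>\<^sub>M imag_units_area. P (slice_point (snd x) (fst x))"
    using AE_distrD [OF measurable_slice_point_half, of P] assms
    unfolding bdry_measure_half [symmetric] by (simp only: case_prod_beta)
  from AE_pair [OF this] show ?thesis by simp
qed

lemma AE_bdry_measureI:
  assumes "{x \<in> space bdry_measure. P x} \<in> sets bdry_measure"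
    and "AE t in half_circle. AE I in imag_units_area. P (slice_point I t)"
  shows "AE x in bdry_measure. P x"
proof -
  interpret pair_sigma_finite half_circle imag_units_area by (rule pair_sigma_finite_half_circle)
  have P: "Measurable.pred bdry_measure P"
    using assms(1) by (simp add: pred_def)
  have "AE x in half_circle \<Otimes>\<^sub>M imag_units_area. P (slice_point (snd x) (fst x))"
    by (rule AE_pair_measure)
      (use assms(2) measurable_compose_slice_point [OF P] in \<open>simp_all add: pred_def\<close>)
  then show ?thesis
    using AE_distr_iff [OF measurable_slice_point_half, of P] assms(1)
    unfolding bdry_measure_half [symmetric] by (simp add: case_prod_beta space_restrict_space)
qed

lemma integral_bdry_measure_half:
  fixes g :: "quaternion \<Rightarrow> 'b :: {banach, second_countable_topology}"
  assumes g: "integrable bdry_measure g"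
  shows "(\<integral>x. g x \<partial>bdry_measure) = (\<integral>t. \<integral>I. g (slice_point I t) \<partial>imag_units_area \<partial>half_circle)"
    and "AE t in half_circle. integrable imag_units_area (\<lambda>I. g (slice_point I t))"
proof -
  interpret pair_sigma_finite half_circle imag_units_area by (rule pair_sigma_finite_half_circle)
  have gm: "g \<in> borel_measurable (restrict_space borel (sphere 0 1))"
    using g by (simp flip: measurable_bdry_measure_iff)
  have int: "integrable (half_circle \<Otimes>\<^sub>M imag_units_area) (\<lambda>x. g (slice_point (snd x) (fst x)))"
    using g integrable_distr_eq [OF measurable_slice_point_half gm]
    unfolding bdry_measure_half [symmetric] by (simp only: case_prod_beta)
  show "AE t in half_circle. integrable imag_units_area (\<lambda>I. g (slice_point I t))"
    using AE_integrable_fst' [OF int] by simp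
  have "(\<integral>x. g x \<partial>bdry_measure) = (\<integral>x. g (slice_point (snd x) (fst x)) \<partial>(half_circle \<Otimes>\<^sub>M imag_units_area))"
    using integral_distr [OF measurable_slice_point_half gm]
    unfolding bdry_measure_half [symmetric] by (simp only: case_prod_beta)
  then show "(\<integral>x. g x \<partial>bdry_measure) = (\<integral>t. \<integral>I. g (slice_point I t) \<partial>imag_units_area \<partial>half_circle)"
    using integral_fst' [OF int] by simp
qed

lemma AE_half_circle_interior: "AE t in half_circle. 0 < t \<and> t < pi"
proof (rule AE_uniform_measureI)
  show "AE t in lborel. t \<in> {0..pi} \<longrightarrow> 0 < t \<and> t < pi"
    using AE_lborel_singleton [of 0] AE_lborel_singleton [of pi] by eventually_elim auto
qed simp

lemma measurable_compose_slice_point_fiber: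
  assumes "f \<in> bdry_measure \<rightarrow>\<^sub>M K"
  shows "(\<lambda>I. f (slice_point I t)) \<in> imag_units_area \<rightarrow>\<^sub>M K"
proof -
  have "(\<lambda>I. (t, I)) \<in> imag_units_area \<rightarrow>\<^sub>M half_circle \<Otimes>\<^sub>M imag_units_area"
    by simp
  from measurable_compose [OF this measurable_compose_slice_point [OF assms]]
  show ?thesis by simp
qed

lemma measurable_ident_imag_units_area [measurable]: "(\<lambda>I. I) \<in> borel_measurable imag_units_area"
  by (simp add: measurable_imag_units_area_iff measurable_restrict_space1)

lemma measurable_ident_bdry_measure [measurable]: "(\<lambda>x. x) \<in> borel_measurable bdry_measure"
  by (simp add: measurable_bdry_measure_iff measurable_restrict_space1)

section \<open>Moments of the imaginary units and of the kernel\<close>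

lemma norm_imag_unit: "I \<in> imag_units \<Longrightarrow> norm I = 1"
  by (auto simp: imag_units_iff norm_quaternion_def)

lemma imag_unit_mult_self: "I \<in> imag_units \<Longrightarrow> I * I = - 1"
  by (simp add: imag_units_def power2_eq_square)

text \<open>
  Antipodal symmetry makes the mean equal to its own negative. This is what separates the
  coefficients \<open>a\<close> and \<open>b\<close> of a slice function \<open>a + I b\<close>.
\<close>

lemma integral_imag_units_area_ident: "(\<integral>I. I \<partial>imag_units_area) = 0"
proof -
  have "(\<integral>I. I \<partial>imag_units_area) = (\<integral>I. I \<partial>distr imag_units_area imag_units_area uminus)"
    by (simp add: distr_imag_units_area_uminus)
  also have "\<dots> = - (\<integral>I. I \<partial>imag_units_area)"
    by (subst integral_distr) auto
  finally have "(2::real) *\<^sub>R (\<integral>I. I \<partial>imag_units_area) = 0"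
    by (metis add.right_inverse scaleR_2)
  then show ?thesis by simp
qed

lemma norm_one_minus_imag_units_mult:
  assumes "J \<in> imag_units"
  shows "norm (1 - J * I) = norm (I + J)"
proof -
  have "1 - J * I = - J * (I + J)"
    using imag_unit_mult_self [OF assms] by (simp add: algebra_simps)
  then show ?thesis by (simp add: norm_mult norm_imag_unit assms)
qed

lemma norm_add_imag_units:
  assumes "I \<in> imag_units" "J \<in> imag_units"
  shows "norm (I + J) = sqrt (2 + 2 * (I \<bullet> J))"
  using norm_imag_unit [OF assms(1)] norm_imag_unit [OF assms(2)]
  by (simp add: norm_eq_sqrt_inner inner_add_left inner_add_right inner_commute)

text \<open>
  As \<open>|I + J|\<^sup>2 = 2 + 2 c\<close> with \<open>c\<close> the inner product of \<open>I\<close> and \<open>J\<close>, the hat-box theorem turns the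
  integral into \<open>1/2 \<integral> (2 + 2 c)\<^sup>q\<^sup>/\<^sup>2 dc\<close> over \<open>[-1, 1]\<close>. For \<open>q = 1\<close> the value is \<open>4/3\<close>.
\<close>

lemma integral_norm_add_imag_units_powr:
  fixes q :: real
  assumes J: "J \<in> imag_units" and q: "0 < q"
  shows "integrable imag_units_area (\<lambda>I. norm (I + J) powr q)"
    and "(\<integral>I. norm (I + J) powr q \<partial>imag_units_area) = 2 powr q * (2 / (q + 2))"
proof -
  interpret prob_space imag_units_area by (rule prob_space_imag_units_area)
  show "integrable imag_units_area (\<lambda>I. norm (I + J) powr q)"
  proof (rule integrable_const_bound)
    have "norm (I + J) powr q \<le> 2 powr q" if "I \<in> imag_units" for I
      using norm_triangle_ineq [of I J] norm_imag_unit J that q by (intro powr_mono2) auto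
    then show "AE I in imag_units_area. norm (norm (I + J) powr q) \<le> 2 powr q"
      by auto
  qed measurable
  have eq: "norm (I + J) powr q = (2 + 2 * (I \<bullet> J)) powr (q / 2)" if "I \<in> imag_units" for I
  proof -
    have "0 \<le> 2 + 2 * (I \<bullet> J)" using inner_imag_units_in_Icc [OF that J] by auto
    then show ?thesis
      by (simp add: norm_add_imag_units that J powr_half_sqrt [symmetric] powr_powr)
  qed
  have "(\<integral>I. norm (I + J) powr q \<partial>imag_units_area) = (\<integral>I. (2 + 2 * (I \<bullet> J)) powr (q / 2) \<partial>imag_units_area)"
    by (rule Bochner_Integration.integral_cong) (auto simp: eq)
  also have "\<dots> = integral {-1..1} (\<lambda>c. (2 + 2 * c) powr (q / 2)) / 2"
    by (rule integral_zonal_imag_units [where h = "\<lambda>c. (2 + 2 * c) powr (q / 2)"])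
      (use q J in \<open>auto intro!: continuous_intros continuous_on_powr'\<close>)
  also have "integral {-1..1} (\<lambda>c. (2 + 2 * c) powr (q / 2)) = 2 * (2 powr q * (2 / (q + 2)))"
  proof -
    define F where "F c = (2 + 2 * c) powr (q / 2 + 1) / (q + 2)" for c :: real
    have "((\<lambda>c. (2 + 2 * c) powr (q / 2)) has_integral F 1 - F (-1)) {-1..1}"
    proof (rule fundamental_theorem_of_calculus_interior)
      show "continuous_on {-1..1} F"
        unfolding F_def using q by (auto intro!: continuous_intros continuous_on_powr')
      fix c :: real assume "c \<in> {-1<..<1}"
      then have "(F has_real_derivative (q / 2 + 1) * (2 + 2 * c) powr (q / 2 + 1 - 1) * 2 / (q + 2)) (at c)"
        unfolding F_def using q by (auto intro!: derivative_eq_intros)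
      moreover have "(q / 2 + 1) * (2 + 2 * c) powr (q / 2 + 1 - 1) * 2 / (q + 2) = (2 + 2 * c) powr (q / 2)"
      proof -
        have "(q / 2 + 1) * X * 2 / (q + 2) = X" for X
          using q by (simp add: field_simps)
        then show ?thesis unfolding add_diff_cancel_right' .
      qed
      ultimately have "(F has_real_derivative (2 + 2 * c) powr (q / 2)) (at c)"
        by (simp only:)
      then show "(F has_vector_derivative (2 + 2 * c) powr (q / 2)) (at c)"
        by (simp add: has_real_derivative_iff_has_vector_derivative)
    qed simp
    moreover have "F 1 - F (-1) = 2 * (2 powr q * (2 / (q + 2)))"
    proof -
      have "(4::real) powr (q / 2 + 1) = (2 powr 2) powr (q / 2 + 1)"
        by simp
      also have "\<dots> = 2 powr (q + 2)"
        unfolding powr_powr by (rule arg_cong [of _ _ "\<lambda>s. 2 powr s"]) simp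
      also have "\<dots> = 4 * 2 powr q"
        by (simp add: powr_add)
      finally show ?thesis
        by (simp add: F_def)
    qed
    ultimately show ?thesis
      by (simp add: integral_unique)
  qed
  also have "2 * (2 powr q * (2 / (q + 2))) / 2 = 2 powr q * (2 / (q + 2))"
    by (rule nonzero_mult_div_cancel_left) simp
  finally show "(\<integral>I. norm (I + J) powr q \<partial>imag_units_area) = 2 powr q * (2 / (q + 2))" .
qed

section \<open>Hoelder's inequality and the Lebesgue norms\<close>

text \<open>
  Stated with arbitrary upper bounds \<open>a\<close> and \<open>b\<close> for the two norms, so that it can be applied without
  computing the norms. After division by \<open>a\<close> and \<open>b\<close> it is Young's inequality, integrated.
\<close>

lemma Holder_nn_integral:
  fixes f g :: "'a \<Rightarrow> real"
  assumes [measurable]: "f \<in> borel_measurable M" "g \<in> borel_measurable M"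
    and nonneg: "\<And>x. 0 \<le> f x" "\<And>x. 0 \<le> g x" "0 \<le> a" "0 \<le> b"
    and pq: "1 < p" "1 < q" "1 / p + 1 / q = 1"
    and f: "(\<integral>\<^sup>+x. ennreal (f x powr p) \<partial>M) \<le> ennreal (a powr p)"
    and g: "(\<integral>\<^sup>+x. ennreal (g x powr q) \<partial>M) \<le> ennreal (b powr q)"
  shows "(\<integral>\<^sup>+x. ennreal (f x * g x) \<partial>M) \<le> ennreal (a * b)"
proof (cases "a = 0 \<or> b = 0")
  case True
  have "AE x in M. f x * g x = 0"
  proof (cases "a = 0")
    case True
    then have "(\<integral>\<^sup>+x. ennreal (f x powr p) \<partial>M) = 0" using f by simp
    then have "AE x in M. ennreal (f x powr p) = 0" by (subst (asm) nn_integral_0_iff_AE) auto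
    then show ?thesis by eventually_elim (auto simp: ennreal_eq_0_iff)
  next
    case False
    with \<open>a = 0 \<or> b = 0\<close> have "(\<integral>\<^sup>+x. ennreal (g x powr q) \<partial>M) = 0" using g by simp
    then have "AE x in M. ennreal (g x powr q) = 0" by (subst (asm) nn_integral_0_iff_AE) auto
    then show ?thesis by eventually_elim (auto simp: ennreal_eq_0_iff)
  qed
  then have "AE x in M. ennreal (f x * g x) = 0" by eventually_elim (simp only: ennreal_0)
  then have "(\<integral>\<^sup>+x. ennreal (f x * g x) \<partial>M) = 0"
    by (subst nn_integral_0_iff_AE) auto
  then show ?thesis by simp
next
  case False
  with nonneg have ab: "0 < a" "0 < b" by auto
  \<comment> \<open>weights that undo the normalization of \<open>f\<close> by \<open>a\<close> and of \<open>g\<close> by \<open>b\<close> in Young's inequality\<close>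
  define A where "A = b * a / (p * a powr p)"
  define B where "B = b * a / (q * b powr q)"
  have A: "0 \<le> A" "A * a powr p = b * a / p" and B: "0 \<le> B" "B * b powr q = b * a / q"
    using ab pq by (auto simp: A_def B_def)
  have young: "f x * g x \<le> A * f x powr p + B * g x powr q" for x
  proof -
    have "(f x / a) * (g x / b) \<le> (f x / a) powr p / p + (g x / b) powr q / q"
      using nonneg ab pq by (intro Youngs_inequality) auto
    then have "(b * a) * ((f x / a) * (g x / b)) \<le> (b * a) * ((f x / a) powr p / p + (g x / b) powr q / q)"
      using ab by (intro mult_left_mono) auto
    also have "(b * a) * ((f x / a) * (g x / b)) = f x * g x" using ab by simp
    also have "(b * a) * ((f x / a) powr p / p + (g x / b) powr q / q) = A * f x powr p + B * g x powr q"
      using nonneg ab by (simp add: powr_divide A_def B_def distrib_left mult_ac)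
    finally show ?thesis .
  qed
  have "(\<integral>\<^sup>+x. ennreal (f x * g x) \<partial>M) \<le> (\<integral>\<^sup>+x. ennreal A * ennreal (f x powr p) + ennreal B * ennreal (g x powr q) \<partial>M)"
  proof (intro nn_integral_mono)
    fix x
    have "ennreal (f x * g x) \<le> ennreal (A * f x powr p + B * g x powr q)"
      by (rule ennreal_leI [OF young])
    also have "\<dots> = ennreal A * ennreal (f x powr p) + ennreal B * ennreal (g x powr q)"
      using A(1) B(1) by (subst ennreal_plus) (simp_all add: ennreal_mult)
    finally show "ennreal (f x * g x) \<le> ennreal A * ennreal (f x powr p) + ennreal B * ennreal (g x powr q)" .
  qed
  also have "\<dots> = ennreal A * (\<integral>\<^sup>+x. ennreal (f x powr p) \<partial>M) + ennreal B * (\<integral>\<^sup>+x. ennreal (g x powr q) \<partial>M)"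
    by (simp add: nn_integral_add nn_integral_cmult)
  also have "\<dots> \<le> ennreal A * ennreal (a powr p) + ennreal B * ennreal (b powr q)"
    by (intro add_mono mult_left_mono f g) auto
  also have "\<dots> = ennreal (A * a powr p + B * b powr q)"
    using A(1) B(1) by (subst ennreal_plus) (simp_all add: ennreal_mult)
  also have "A * a powr p + B * b powr q = b * a * (1 / p + 1 / q)"
    unfolding A(2) B(2) distrib_left by simp
  also have "\<dots> = a * b" unfolding pq(3) by simp
  finally show ?thesis .
qed

text \<open>
  Removes the \<open>p\<close>-th root: estimates of norms become estimates of integrals of extended
  nonnegative functions, with no case distinction on finiteness.
\<close>

lemma Lp_norm_le_iff:
  assumes p: "1 \<le> p" and c: "0 \<le> c"
  shows "Lp_norm (ennreal p) f \<le> ennreal c \<longleftrightarrow>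
    (\<integral>\<^sup>+x. ennreal (norm (f x) powr p) \<partial>bdry_measure) \<le> ennreal (c powr p)"
proof (cases "\<integral>\<^sup>+x. ennreal (norm (f x) powr p) \<partial>bdry_measure")
  case (real n)
  have "n powr (1 / p) \<le> c \<longleftrightarrow> n \<le> c powr p"
  proof
    assume "n powr (1 / p) \<le> c"
    from powr_mono2 [OF _ _ this, of p] show "n \<le> c powr p"
      using p real by (simp add: powr_powr)
  next
    assume "n \<le> c powr p"
    from powr_mono2 [OF _ _ this, of "1 / p"] show "n powr (1 / p) \<le> c"
      using p c real by (simp add: powr_powr)
  qed
  then show ?thesis
    using real p c by (simp add: Lp_norm_def Let_def)
next
  case top
  then show ?thesis
    using p by (simp add: Lp_norm_def Let_def top_unique)
qed

lemma Lp_norm_infinity_le_iff: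
  assumes f: "f \<in> borel_measurable bdry_measure"
  shows "Lp_norm \<infinity> f \<le> c \<longleftrightarrow> (AE x in bdry_measure. ennreal (norm (f x)) \<le> c)"
proof
  assume "Lp_norm \<infinity> f \<le> c"
  then show "AE x in bdry_measure. ennreal (norm (f x)) \<le> c"
    using esssup_AE [of "\<lambda>x. ennreal (norm (f x))" bdry_measure]
    by (auto simp: Lp_norm_def intro: order_trans)
next
  assume "AE x in bdry_measure. ennreal (norm (f x)) \<le> c"
  then show "Lp_norm \<infinity> f \<le> c"
    using f by (auto simp: Lp_norm_def intro!: esssup_I)
qed

lemma exponent_cases [consumes 1, case_names infinite finite]:
  assumes "1 \<le> (p :: ennreal)"
  obtains "p = \<infinity>" | r where "p = ennreal r" "1 \<le> r"
  using assms by (cases p) (auto simp: ennreal_le_1 one_ennreal.rep_eq simp flip: ennreal_1)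

lemma Lp_norm_cong_AE:
  assumes [measurable]: "f \<in> borel_measurable bdry_measure" "g \<in> borel_measurable bdry_measure"
    and "AE x in bdry_measure. f x = g x"
  shows "Lp_norm p f = Lp_norm p g"
proof -
  have "esssup bdry_measure (\<lambda>x. ennreal (norm (f x))) = esssup bdry_measure (\<lambda>x. ennreal (norm (g x)))"
    using assms(3) by (intro esssup_AE_cong) (measurable, auto)
  moreover have "(\<integral>\<^sup>+x. ennreal (norm (f x) powr enn2real p) \<partial>bdry_measure) =
      (\<integral>\<^sup>+x. ennreal (norm (g x) powr enn2real p) \<partial>bdry_measure)"
    using assms(3) by (intro nn_integral_cong_AE) auto
  ultimately show ?thesis unfolding Lp_norm_def by simp
qed

lemma Lp_norm_eq_0D:
  assumes [measurable]: "f \<in> borel_measurable bdry_measure" and p: "1 \<le> p" and f: "Lp_norm p f = 0"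
  shows "AE x in bdry_measure. f x = 0"
  using p
proof (cases rule: exponent_cases)
  case infinite
  have "AE x in bdry_measure. ennreal (norm (f x)) \<le> 0"
    using f Lp_norm_infinity_le_iff [OF assms(1), of 0] unfolding infinite by simp
  then show ?thesis by eventually_elim simp
next
  case (finite r)
  have "(\<integral>\<^sup>+x. ennreal (norm (f x) powr r) \<partial>bdry_measure) = 0"
    using Lp_norm_le_iff [OF finite(2), of 0 f] f finite by simp
  then have "AE x in bdry_measure. ennreal (norm (f x) powr r) = 0"
    by (subst (asm) nn_integral_0_iff_AE) auto
  then show ?thesis by eventually_elim (auto simp: ennreal_eq_0_iff)
qed

lemma conjugate_exponent_cases:
  assumes "1 \<le> (p :: ennreal)" "1 \<le> q" "1 / p + 1 / q = 1"
  obtains "p = \<infinity>" "q = 1" | "p = 1" "q = \<infinity>"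
  | r s where "p = ennreal r" "q = ennreal s" "1 < r" "1 < s" "1 / r + 1 / s = 1"
proof -
  have inf: "b = 1" if "1 \<le> b" "1 / b = 1" for b :: ennreal
    using that(1)
  proof (cases rule: exponent_cases)
    case infinite
    then show ?thesis using that by simp
  next
    case (finite r)
    then have "ennreal (1 / r) = 1" using that divide_ennreal [of 1 r] by simp
    then show ?thesis using finite by simp
  qed
  have one: "b = \<infinity>" if "1 \<le> b" "1 + 1 / b = 1" for b :: ennreal
    using that(1)
  proof (cases rule: exponent_cases)
    case (finite r)
    then have "ennreal (1 + 1 / r) = 1" using that divide_ennreal [of 1 r] by simp
    then show ?thesis using finite by simp
  qed
  show ?thesis
    using assms(1)
  proof (cases rule: exponent_cases)
    case infinite
    then show ?thesis using assms inf [of q] that(1) by simp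
  next
    case p: (finite r)
    show ?thesis
      using assms(2)
    proof (cases rule: exponent_cases)
      case infinite
      then show ?thesis using assms inf [of p] that(2) by simp
    next
      case q: (finite s)
      have e: "ennreal (1 / r + 1 / s) = 1"
        using assms(3) p q divide_ennreal [of 1 r] divide_ennreal [of 1 s] by simp
      then have sum: "1 / r + 1 / s = 1"
        using e by (simp only: ennreal_eq_1)
      then have "r \<noteq> 1" "s \<noteq> 1" using p q by auto
      then show ?thesis using that(3) [OF p(1) q(1)] p q sum by simp
    qed
  qed
qed

lemma Holder_Lp_norm:
  assumes pq: "1 \<le> p" "1 \<le> q" "1 / p + 1 / q = 1" and f: "f \<in> Lp_space p" and g: "g \<in> Lp_space q"
  shows "(\<integral>\<^sup>+x. ennreal (norm (f x) * norm (g x)) \<partial>bdry_measure) \<le> Lp_norm p f * Lp_norm q g"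
proof -
  have [measurable]: "f \<in> borel_measurable bdry_measure" "g \<in> borel_measurable bdry_measure"
    using f g by (auto simp: Lp_space_def)
  have sup_one: "(\<integral>\<^sup>+x. ennreal (norm (f x) * norm (g x)) \<partial>bdry_measure) \<le> Lp_norm \<infinity> f * Lp_norm 1 g"
    if f: "f \<in> Lp_space \<infinity>" and g: "g \<in> Lp_space 1" for f g
  proof -
    have [measurable]: "f \<in> borel_measurable bdry_measure" "g \<in> borel_measurable bdry_measure"
      using f g by (auto simp: Lp_space_def)
    obtain b where b: "Lp_norm 1 g = ennreal b" "0 \<le> b"
      using g by (cases "Lp_norm 1 g") (auto simp: Lp_space_def)
    have "AE x in bdry_measure. ennreal (norm (f x)) \<le> Lp_norm \<infinity> f"
      using Lp_norm_infinity_le_iff [of f "Lp_norm \<infinity> f"] by simp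
    then have "(\<integral>\<^sup>+x. ennreal (norm (f x) * norm (g x)) \<partial>bdry_measure) \<le>
        (\<integral>\<^sup>+x. Lp_norm \<infinity> f * ennreal (norm (g x)) \<partial>bdry_measure)"
      by (intro nn_integral_mono_AE) (auto simp: ennreal_mult intro!: mult_right_mono)
    also have "\<dots> = Lp_norm \<infinity> f * (\<integral>\<^sup>+x. ennreal (norm (g x)) \<partial>bdry_measure)"
      by (rule nn_integral_cmult) simp
    also have "\<dots> \<le> Lp_norm \<infinity> f * Lp_norm 1 g"
      using Lp_norm_le_iff [of 1 b g] b by (intro mult_left_mono) simp_all
    finally show ?thesis .
  qed
  show ?thesis
    using pq
  proof (cases rule: conjugate_exponent_cases)
    case 1
    then show ?thesis using sup_one [of f g] f g by simp
  next
    case 2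
    then show ?thesis using sup_one [of g f] f g by (simp add: mult.commute)
  next
    case (3 r s)
    obtain a where a: "Lp_norm p f = ennreal a" "0 \<le> a"
      using f by (cases "Lp_norm p f") (auto simp: Lp_space_def)
    obtain b where b: "Lp_norm q g = ennreal b" "0 \<le> b"
      using g by (cases "Lp_norm q g") (auto simp: Lp_space_def)
    have "(\<integral>\<^sup>+x. ennreal (norm (f x) * norm (g x)) \<partial>bdry_measure) \<le> ennreal (a * b)"
      by (rule Holder_nn_integral [OF _ _ _ _ _ _ 3(3-5)])
        (use a b 3 Lp_norm_le_iff [of r a f] Lp_norm_le_iff [of s b g] in simp_all)
    then show ?thesis using a b by (simp add: ennreal_mult)
  qed
qed

section \<open>Orthogonality in the quaternionic Hilbert space\<close>

lemma bounded_linear_quat_cnj: "bounded_linear quat_cnj"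
  by (intro linear_conv_bounded_linear [THEN iffD1] linearI) (simp_all add: quat_cnj_def quaternion_eq_iff)

lemma borel_measurable_quat_cnj [measurable (raw)]:
  "f \<in> borel_measurable M \<Longrightarrow> (\<lambda>x. quat_cnj (f x)) \<in> borel_measurable M"
  by (rule borel_measurable_continuous_on [OF linear_continuous_on [OF bounded_linear_quat_cnj]])

lemma norm_quat_cnj [simp]: "norm (quat_cnj q) = norm q"
  by (simp add: quat_cnj_def norm_quaternion_def)

lemma quat_cnj_mult: "quat_cnj (a * b) = quat_cnj b * quat_cnj a"
  by (simp add: quat_cnj_def quaternion_eq_iff)

lemma quat_cnj_add: "quat_cnj (a + b) = quat_cnj a + quat_cnj b"
  by (simp add: quat_cnj_def quaternion_eq_iff)

lemma quat_cnj_imag_unit: "I \<in> imag_units \<Longrightarrow> quat_cnj I = - I"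
  by (simp add: quat_cnj_def quaternion_eq_iff imag_units_iff)

text \<open>
  The real part of the quaternionic inner product is the Euclidean one. The duality and contraction
  arguments below only use the latter.
\<close>

lemma inner_quat_cnj_mult: "(quat_cnj b * a) \<bullet> 1 = a \<bullet> b"
  by (simp add: quat_cnj_def inner_quaternion_def algebra_simps)

lemma Lp_space_2_iff:
  "f \<in> Lp_space 2 \<longleftrightarrow> f \<in> borel_measurable bdry_measure \<and> integrable bdry_measure (\<lambda>x. (norm (f x))\<^sup>2)"
proof -
  have "(\<integral>\<^sup>+x. ennreal (norm (f x) powr 2) \<partial>bdry_measure) = (\<integral>\<^sup>+x. ennreal ((norm (f x))\<^sup>2) \<partial>bdry_measure)"
    by simp
  then show ?thesis
    unfolding Lp_space_def Lp_norm_def Let_def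
    by (auto simp: integrable_iff_bounded less_top)
qed

lemma Lp_space_2_integrable:
  assumes f: "f \<in> Lp_space 2" and g: "g \<in> Lp_space 2"
  shows "integrable bdry_measure (\<lambda>x. norm (f x) * norm (g x))"
    and "integrable bdry_measure (\<lambda>x. f x \<bullet> g x)"
    and "integrable bdry_measure (\<lambda>x. quat_cnj (g x) * f x)"
proof -
  have [measurable]: "f \<in> borel_measurable bdry_measure" "g \<in> borel_measurable bdry_measure"
    and int: "integrable bdry_measure (\<lambda>x. (norm (f x))\<^sup>2 + (norm (g x))\<^sup>2)"
    using f g by (auto simp: Lp_space_2_iff)
  have le: "norm (f x) * norm (g x) \<le> (norm (f x))\<^sup>2 + (norm (g x))\<^sup>2" for x
  proof -
    have "0 \<le> norm (f x) * norm (g x)" by simp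
    then show ?thesis
      using sum_squares_bound [of "norm (f x)" "norm (g x)"] unfolding mult.assoc by linarith
  qed
  show *: "integrable bdry_measure (\<lambda>x. norm (f x) * norm (g x))"
    by (rule Bochner_Integration.integrable_bound [OF int]) (use le in auto)
  show "integrable bdry_measure (\<lambda>x. f x \<bullet> g x)"
    by (rule Bochner_Integration.integrable_bound [OF *]) (use Cauchy_Schwarz_ineq2 in auto)
  show "integrable bdry_measure (\<lambda>x. quat_cnj (g x) * f x)"
    by (rule Bochner_Integration.integrable_bound [OF *]) (auto simp: norm_mult mult.commute)
qed

lemma Lp_space_2_integrable_self:
  assumes "f \<in> Lp_space 2"
  shows "integrable bdry_measure f"
proof -
  interpret prob_space bdry_measure by (rule prob_space_bdry_measure)
  have "(\<lambda>x. 1) \<in> Lp_space 2" by (simp add: Lp_space_2_iff)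
  from Lp_space_2_integrable(3) [OF assms this] show ?thesis
    by (simp add: quat_cnj_def flip: one_quaternion_def)
qed

lemma Lp_space_2_diff:
  assumes f: "f \<in> Lp_space 2" and g: "g \<in> Lp_space 2"
  shows "(\<lambda>x. f x - g x) \<in> Lp_space 2"
proof -
  have [measurable]: "f \<in> borel_measurable bdry_measure" "g \<in> borel_measurable bdry_measure"
    using f g by (auto simp: Lp_space_2_iff)
  have "integrable bdry_measure (\<lambda>x. (norm (f x))\<^sup>2 + (norm (g x))\<^sup>2 - 2 * (f x \<bullet> g x))"
    using f g Lp_space_2_integrable(2) [OF f g] by (auto simp: Lp_space_2_iff)
  also have "(\<lambda>x. (norm (f x))\<^sup>2 + (norm (g x))\<^sup>2 - 2 * (f x \<bullet> g x)) = (\<lambda>x. (norm (f x - g x))\<^sup>2)"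
    by (auto simp: power2_norm_eq_inner inner_diff_left inner_diff_right inner_commute)
  finally show ?thesis by (simp add: Lp_space_2_iff)
qed

definition is_slice_proj :: "(quaternion \<Rightarrow> quaternion) \<Rightarrow> (quaternion \<Rightarrow> quaternion) \<Rightarrow> bool" where
  "is_slice_proj \<phi> \<psi> \<longleftrightarrow> \<psi> \<in> slice_Lp_space 2 \<and>
     (\<forall>g \<in> slice_Lp_space 2. L2_inner (\<lambda>x. \<phi> x - \<psi> x) g = 0)"

lemma slice_Lp_space_subset: "f \<in> slice_Lp_space p \<Longrightarrow> f \<in> Lp_space p"
  by (simp add: slice_Lp_space_def)

lemma slice_function_diff:
  assumes "slice_function f" "slice_function g"
  shows "slice_function (\<lambda>x. f x - g x)"
  unfolding slice_function_def
proof (intro ballI allI)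
  fix I J t assume IJ: "I \<in> imag_units" "J \<in> imag_units"
  have F: "f (slice_point J t) = (1 / 2) *\<^sub>R (f (slice_point I t) + f (slice_point I (- t))) +
          ((1 / 2) *\<^sub>R (J * I)) * (f (slice_point I (- t)) - f (slice_point I t))"
    using assms(1) IJ unfolding slice_function_def by blast
  have G: "g (slice_point J t) = (1 / 2) *\<^sub>R (g (slice_point I t) + g (slice_point I (- t))) +
          ((1 / 2) *\<^sub>R (J * I)) * (g (slice_point I (- t)) - g (slice_point I t))"
    using assms(2) IJ unfolding slice_function_def by blast
  show "f (slice_point J t) - g (slice_point J t) =
      (1 / 2) *\<^sub>R (f (slice_point I t) - g (slice_point I t) + (f (slice_point I (- t)) - g (slice_point I (- t)))) +
      ((1 / 2) *\<^sub>R (J * I)) * (f (slice_point I (- t)) - g (slice_point I (- t)) - (f (slice_point I t) - g (slice_point I t)))"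
    unfolding F G by (simp add: algebra_simps)
qed

lemma slice_Lp_space_2_diff:
  assumes "f \<in> slice_Lp_space 2" "g \<in> slice_Lp_space 2"
  shows "(\<lambda>x. f x - g x) \<in> slice_Lp_space 2"
proof -
  obtain f' g' where [measurable]: "f' \<in> borel_measurable bdry_measure" "g' \<in> borel_measurable bdry_measure"
    and s: "slice_function f'" "slice_function g'"
    and ae: "AE x in bdry_measure. f x = f' x" "AE x in bdry_measure. g x = g' x"
    using assms by (auto simp: slice_Lp_space_def)
  from ae have "AE x in bdry_measure. f x - g x = f' x - g' x" by eventually_elim simp
  then show ?thesis
    using assms Lp_space_2_diff [of f g] slice_function_diff [OF s]
    unfolding slice_Lp_space_def by (auto intro!: bexI [of _ "\<lambda>x. f' x - g' x"])
qed

lemma is_slice_proj_inner: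
  assumes \<phi>: "\<phi> \<in> Lp_space 2" and \<psi>: "is_slice_proj \<phi> \<psi>" and g: "g \<in> slice_Lp_space 2"
  shows "(\<integral>x. \<phi> x \<bullet> g x \<partial>bdry_measure) = (\<integral>x. \<psi> x \<bullet> g x \<partial>bdry_measure)"
proof -
  have \<psi>2: "\<psi> \<in> Lp_space 2" and g2: "g \<in> Lp_space 2" and orth: "L2_inner (\<lambda>x. \<phi> x - \<psi> x) g = 0"
    using \<psi> g by (auto simp: is_slice_proj_def dest: slice_Lp_space_subset)
  have "0 = (\<integral>x. quat_cnj (g x) * (\<phi> x - \<psi> x) \<partial>bdry_measure) \<bullet> 1"
    using orth by (simp add: L2_inner_def)
  also have "\<dots> = (\<integral>x. (quat_cnj (g x) * (\<phi> x - \<psi> x)) \<bullet> 1 \<partial>bdry_measure)"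
    by (rule integral_inner_left [symmetric])
      (rule Lp_space_2_integrable(3) [OF Lp_space_2_diff [OF \<phi> \<psi>2] g2])
  also have "\<dots> = (\<integral>x. \<phi> x \<bullet> g x - \<psi> x \<bullet> g x \<partial>bdry_measure)"
    by (simp add: inner_quat_cnj_mult inner_diff_left)
  also have "\<dots> = (\<integral>x. \<phi> x \<bullet> g x \<partial>bdry_measure) - (\<integral>x. \<psi> x \<bullet> g x \<partial>bdry_measure)"
    by (rule Bochner_Integration.integral_diff) (intro Lp_space_2_integrable \<phi> \<psi>2 g2)+
  finally show ?thesis by simp
qed

lemma is_slice_proj_unique:
  assumes \<phi>: "\<phi> \<in> Lp_space 2" and \<psi>: "is_slice_proj \<phi> \<psi>" and \<psi>': "is_slice_proj \<phi> \<psi>'"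
  shows "AE x in bdry_measure. \<psi> x = \<psi>' x"
proof -
  let ?d = "\<lambda>x. \<psi> x - \<psi>' x"
  have s: "\<psi> \<in> slice_Lp_space 2" "\<psi>' \<in> slice_Lp_space 2"
    using \<psi> \<psi>' by (auto simp: is_slice_proj_def)
  have d: "?d \<in> slice_Lp_space 2" by (rule slice_Lp_space_2_diff [OF s])
  note l2 = s [THEN slice_Lp_space_subset] d [THEN slice_Lp_space_subset]
  have "(\<integral>x. (norm (?d x))\<^sup>2 \<partial>bdry_measure) = (\<integral>x. \<psi> x \<bullet> ?d x - \<psi>' x \<bullet> ?d x \<partial>bdry_measure)"
    by (simp add: power2_norm_eq_inner inner_diff_left)
  also have "\<dots> = 0"
    using is_slice_proj_inner [OF \<phi> \<psi> d] is_slice_proj_inner [OF \<phi> \<psi>' d]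
    by (subst Bochner_Integration.integral_diff) (auto intro: Lp_space_2_integrable l2)
  finally have "AE x in bdry_measure. (norm (?d x))\<^sup>2 = 0"
    using l2(3) by (subst (asm) integral_nonneg_eq_0_iff_AE) (auto simp: Lp_space_2_iff)
  then show ?thesis by eventually_elim simp
qed

text \<open>
  Both sides equal the inner product of the two projections.
\<close>

lemma is_slice_proj_symmetric:
  assumes "\<phi> \<in> Lp_space 2" "is_slice_proj \<phi> \<phi>'" "\<psi> \<in> Lp_space 2" "is_slice_proj \<psi> \<psi>'"
  shows "(\<integral>x. \<phi>' x \<bullet> \<psi> x \<partial>bdry_measure) = (\<integral>x. \<phi> x \<bullet> \<psi>' x \<partial>bdry_measure)"
proof -
  have s: "\<phi>' \<in> slice_Lp_space 2" "\<psi>' \<in> slice_Lp_space 2"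
    using assms by (auto simp: is_slice_proj_def)
  have "(\<integral>x. \<phi>' x \<bullet> \<psi> x \<partial>bdry_measure) = (\<integral>x. \<psi>' x \<bullet> \<phi>' x \<partial>bdry_measure)"
    using is_slice_proj_inner [OF assms(3,4) s(1)] by (simp add: inner_commute)
  also have "\<dots> = (\<integral>x. \<phi> x \<bullet> \<psi>' x \<partial>bdry_measure)"
    using is_slice_proj_inner [OF assms(1,2) s(2)] by (simp add: inner_commute)
  finally show ?thesis .
qed

section \<open>The projection as an average over spheres\<close>

definition slice_mean :: "(quaternion \<Rightarrow> quaternion) \<Rightarrow> real \<Rightarrow> quaternion" where
  "slice_mean \<phi> t = (\<integral>I. \<phi> (slice_point I t) \<partial>imag_units_area)"

text \<open>
  The coefficient of \<open>J\<close>: if \<open>\<phi>(e\<^sup>I\<^sup>t) = a + I b\<close>, then \<open>- I \<phi>(e\<^sup>I\<^sup>t) = - I a + b\<close> has mean \<open>b\<close>.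
\<close>

definition slice_moment :: "(quaternion \<Rightarrow> quaternion) \<Rightarrow> real \<Rightarrow> quaternion" where
  "slice_moment \<phi> t = - (\<integral>I. I * \<phi> (slice_point I t) \<partial>imag_units_area)"

text \<open>
  At \<open>e\<^sup>J\<^sup>t\<close> with \<open>t\<close> in \<open>(0, \<pi>)\<close> the arc cosine recovers \<open>t\<close> and the sign factor recovers \<open>J\<close>. At the
  two real points the sign factor is \<open>0\<close>; a slice function has to be independent of \<open>J\<close> there, so
  that only the mean can remain.
\<close>

definition slice_average :: "(quaternion \<Rightarrow> quaternion) \<Rightarrow> quaternion \<Rightarrow> quaternion" where
  "slice_average \<phi> x = slice_mean \<phi> (arccos (Re_quat x)) +
     sgn (x - of_real (Re_quat x)) * slice_moment \<phi> (arccos (Re_quat x))"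

lemma Re_quat_slice_point: "I \<in> imag_units \<Longrightarrow> Re_quat (slice_point I t) = cos t"
  by (simp add: slice_point_def of_real_def imag_units_iff)

lemma slice_average_slice_point:
  assumes J: "J \<in> imag_units"
  shows "slice_average \<phi> (slice_point J t) = slice_mean \<phi> (arccos (cos t)) +
     J * (sgn (sin t) *\<^sub>R slice_moment \<phi> (arccos (cos t)))"
proof -
  have "slice_point J t - of_real (cos t) = sin t *\<^sub>R J"
    by (simp add: slice_point_def of_real_def)
  then show ?thesis
    using norm_imag_unit [OF J]
    by (simp add: slice_average_def Re_quat_slice_point [OF J] sgn_scaleR sgn_div_norm [of J])
qed

lemma slice_average_slice_point_interior:
  assumes "J \<in> imag_units" "0 < t" "t < pi"
  shows "slice_average \<phi> (slice_point J t) = slice_mean \<phi> t + J * slice_moment \<phi> t"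
  using assms by (simp add: slice_average_slice_point arccos_cos sin_gt_zero)

text \<open>
  The parity conditions express that \<open>(J, t)\<close> and \<open>(- J, - t)\<close> are the same point.
\<close>

lemma slice_function_of_even_odd:
  assumes "\<And>J t. J \<in> imag_units \<Longrightarrow> f (slice_point J t) = a t + J * b t"
    and "\<And>t. a (- t) = a t" "\<And>t. b (- t) = - b t"
  shows "slice_function f"
  unfolding slice_function_def
proof (intro ballI allI)
  fix I J t assume IJ: "I \<in> imag_units" "J \<in> imag_units"
  have "f (slice_point I (- t)) - f (slice_point I t) = - (2 *\<^sub>R (I * b t))"
    using IJ by (simp add: assms scaleR_2)
  moreover have "f (slice_point I t) + f (slice_point I (- t)) = 2 *\<^sub>R a t"
    using IJ by (simp add: assms scaleR_2)
  moreover have "J * I * (I * b t) = - (J * b t)"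
  proof -
    have "J * I * (I * b t) = J * (I * I) * b t"
      by (simp only: mult.assoc)
    then show ?thesis by (simp add: imag_unit_mult_self [OF IJ(1)])
  qed
  ultimately show "f (slice_point J t) = (1 / 2) *\<^sub>R (f (slice_point I t) + f (slice_point I (- t))) +
          ((1 / 2) *\<^sub>R (J * I)) * (f (slice_point I (- t)) - f (slice_point I t))"
    unfolding assms(1) [OF IJ(2)] by simp
qed

lemma slice_function_slice_average: "slice_function (slice_average \<phi>)"
  by (rule slice_function_of_even_odd [OF slice_average_slice_point]) simp_all

lemma slice_function_affine_on_fiber:
  assumes f: "slice_function f" and I: "I \<in> imag_units"
  obtains a b where "\<And>J. J \<in> imag_units \<Longrightarrow> f (slice_point J t) = a + J * b"
proof
  fix J assume "J \<in> imag_units"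
  then have "f (slice_point J t) = (1 / 2) *\<^sub>R (f (slice_point I t) + f (slice_point I (- t))) +
          ((1 / 2) *\<^sub>R (J * I)) * (f (slice_point I (- t)) - f (slice_point I t))"
    using f I unfolding slice_function_def by blast
  then show "f (slice_point J t) = (1 / 2) *\<^sub>R (f (slice_point I t) + f (slice_point I (- t))) +
          J * (I * ((1 / 2) *\<^sub>R (f (slice_point I (- t)) - f (slice_point I t))))"
    by (simp only: mult.assoc mult_scaleR_left mult_scaleR_right)
qed

text \<open>
  The two coefficients are measurable in \<open>t\<close> by Fubini's theorem, and the angle is a continuous
  function on the unit sphere.
\<close>

lemma borel_measurable_slice_average [measurable]:
  assumes \<phi> [measurable]: "\<phi> \<in> borel_measurable bdry_measure"
  shows "slice_average \<phi> \<in> borel_measurable bdry_measure"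
proof -
  interpret S: prob_space imag_units_area by (rule prob_space_imag_units_area)
  have half: "borel_measurable half_circle = (borel_measurable borel :: (real \<Rightarrow> quaternion) set)"
    by (rule measurable_cong_sets) simp_all
  note m = measurable_compose_slice_point [OF \<phi>]
  have "(\<lambda>t. \<integral>I. \<phi> (slice_point I t) \<partial>imag_units_area) \<in> borel_measurable half_circle"
    using S.borel_measurable_lebesgue_integral [of "\<lambda>t I. \<phi> (slice_point I t)" half_circle] m
    by (simp add: case_prod_beta)
  then have 1 [measurable]: "slice_mean \<phi> \<in> borel_measurable borel"
    unfolding half slice_mean_def [abs_def] .
  have "(\<lambda>x. snd x * \<phi> (slice_point (snd x) (fst x))) \<in> borel_measurable (half_circle \<Otimes>\<^sub>M imag_units_area)"
    using m by (intro borel_measurable_times measurable_compose [OF measurable_snd measurable_ident_imag_units_area])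
  then have "(\<lambda>t. \<integral>I. I * \<phi> (slice_point I t) \<partial>imag_units_area) \<in> borel_measurable half_circle"
    using S.borel_measurable_lebesgue_integral [of "\<lambda>t I. I * \<phi> (slice_point I t)" half_circle]
    by (simp add: case_prod_beta)
  then have 2 [measurable]: "slice_moment \<phi> \<in> borel_measurable borel"
    unfolding half slice_moment_def [abs_def] by simp
  \<comment> \<open>as an inner product with \<open>1\<close> the real part is visibly continuous\<close>
  have re: "Re_quat x = x \<bullet> 1" for x
    by (simp add: inner_quaternion_def)
  have "\<bar>x \<bullet> 1\<bar> \<le> 1" if "norm x = 1" for x :: quaternion
    using Cauchy_Schwarz_ineq2 [of x 1] that by simp
  then have "continuous_on (sphere (0 :: quaternion) 1) (\<lambda>x. arccos (x \<bullet> 1))"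
    by (intro continuous_on_arccos continuous_intros) (auto simp: abs_le_iff)
  then have 3 [measurable]: "(\<lambda>x. arccos (x \<bullet> 1)) \<in> borel_measurable bdry_measure"
    unfolding measurable_bdry_measure_iff by (rule borel_measurable_continuous_on_restrict)
  have 4 [measurable]: "(\<lambda>x. x \<bullet> 1) \<in> borel_measurable bdry_measure"
    by measurable
  have "(\<lambda>x. slice_mean \<phi> (arccos (x \<bullet> 1)) +
     sgn (x - of_real (x \<bullet> 1)) * slice_moment \<phi> (arccos (x \<bullet> 1))) \<in> borel_measurable bdry_measure"
    unfolding sgn_div_norm of_real_def by measurable
  then show ?thesis
    unfolding slice_average_def [abs_def] re .
qed

lemma integrable_imag_units_area_mult:
  assumes "integrable imag_units_area f"
  shows "integrable imag_units_area (\<lambda>I. I * f I)"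
  by (rule Bochner_Integration.integrable_bound [OF assms])
    (use assms in \<open>auto simp: norm_mult norm_imag_unit\<close>)

lemma slice_average_kernel:
  assumes "integrable imag_units_area (\<lambda>I. \<phi> (slice_point I t))"
  shows "slice_mean \<phi> t + J * slice_moment \<phi> t = (\<integral>I. (1 - J * I) * \<phi> (slice_point I t) \<partial>imag_units_area)"
proof -
  note int = integrable_imag_units_area_mult [OF assms]
  have "(\<integral>I. (1 - J * I) * \<phi> (slice_point I t) \<partial>imag_units_area) =
     (\<integral>I. \<phi> (slice_point I t) - J * (I * \<phi> (slice_point I t)) \<partial>imag_units_area)"
    by (simp add: algebra_simps)
  also have "\<dots> = (\<integral>I. \<phi> (slice_point I t) \<partial>imag_units_area) - J * (\<integral>I. I * \<phi> (slice_point I t) \<partial>imag_units_area)"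
    using assms int
    by (subst Bochner_Integration.integral_diff) (auto simp: integral_mult_right)
  finally show ?thesis
    by (simp add: slice_mean_def slice_moment_def)
qed

lemma norm_slice_average_le:
  assumes int: "integrable imag_units_area (\<lambda>I. \<phi> (slice_point I t))"
    and J: "J \<in> imag_units" and t: "0 < t" "t < pi"
  shows "ennreal (norm (slice_average \<phi> (slice_point J t))) \<le>
    (\<integral>\<^sup>+I. ennreal (norm (I + J) * norm (\<phi> (slice_point I t))) \<partial>imag_units_area)"
proof -
  have "integrable imag_units_area (\<lambda>I. \<phi> (slice_point I t) - J * (I * \<phi> (slice_point I t)))"
    using int integrable_imag_units_area_mult [OF int] by auto
  then have "integrable imag_units_area (\<lambda>I. (1 - J * I) * \<phi> (slice_point I t))"
    by (simp add: algebra_simps)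
  then have "ennreal (norm (\<integral>I. (1 - J * I) * \<phi> (slice_point I t) \<partial>imag_units_area)) \<le>
     (\<integral>\<^sup>+I. ennreal (norm ((1 - J * I) * \<phi> (slice_point I t))) \<partial>imag_units_area)"
    by (rule integral_norm_bound_ennreal)
  then show ?thesis
    by (simp add: slice_average_slice_point_interior [OF J t] slice_average_kernel [OF int] norm_mult
        norm_one_minus_imag_units_mult [OF J])
qed

text \<open>
  For \<open>f = a + I b\<close> the integrand splits into \<open>a\<^sup>* (\<phi> - A - I B)\<close> and \<open>- b\<^sup>* (I \<phi> - I A + B)\<close>, where \<open>A\<close> and
  \<open>B\<close> are the coefficients of the average and the star denotes conjugation. Both brackets have mean \<open>0\<close>
  by the choice of \<open>A\<close> and \<open>B\<close>, because \<open>I\<close> has mean \<open>0\<close>.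
\<close>

lemma slice_average_orthogonal_fiber:
  assumes int: "integrable imag_units_area (\<lambda>I. \<phi> (slice_point I t))" and t: "0 < t" "t < pi"
    and f: "slice_function f"
  shows "(\<integral>I. quat_cnj (f (slice_point I t)) * (\<phi> (slice_point I t) - slice_average \<phi> (slice_point I t))
    \<partial>imag_units_area) = 0"
proof -
  interpret prob_space imag_units_area by (rule prob_space_imag_units_area)
  obtain a b where ab: "\<And>J. J \<in> imag_units \<Longrightarrow> f (slice_point J t) = a + J * b"
    using slice_function_affine_on_fiber [OF f spherical_coords_in_imag_units] by metis
  let ?A = "slice_mean \<phi> t" and ?B = "slice_moment \<phi> t" and ?\<phi> = "\<lambda>I. \<phi> (slice_point I t)"
  note int' = integrable_imag_units_area_mult [OF int]
  have one: "prob imag_units = 1"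
    using prob_space by simp
  have id: "integrable imag_units_area (\<lambda>I. I)"
    by (rule integrable_const_bound [of _ 1]) (auto simp: norm_imag_unit)
  have "(\<integral>I. quat_cnj (f (slice_point I t)) * (?\<phi> I - slice_average \<phi> (slice_point I t)) \<partial>imag_units_area) =
    (\<integral>I. quat_cnj a * (?\<phi> I - ?A - I * ?B) - quat_cnj b * (I * ?\<phi> I - I * ?A + ?B) \<partial>imag_units_area)"
  proof (rule Bochner_Integration.integral_cong [OF refl])
    fix I assume "I \<in> space imag_units_area"
    then have I: "I \<in> imag_units" by simp
    have "I * (I * ?B) = - ?B"
      using imag_unit_mult_self [OF I] by (simp flip: mult.assoc)
    then show "quat_cnj (f (slice_point I t)) * (?\<phi> I - slice_average \<phi> (slice_point I t)) =
      quat_cnj a * (?\<phi> I - ?A - I * ?B) - quat_cnj b * (I * ?\<phi> I - I * ?A + ?B)"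
      by (simp add: ab I slice_average_slice_point_interior [OF I t] quat_cnj_add quat_cnj_mult quat_cnj_imag_unit algebra_simps)
  qed
  also have "\<dots> = quat_cnj a * (\<integral>I. ?\<phi> I - ?A - I * ?B \<partial>imag_units_area) -
      quat_cnj b * (\<integral>I. I * ?\<phi> I - I * ?A + ?B \<partial>imag_units_area)"
    using int int' id by (subst Bochner_Integration.integral_diff) auto
  also have "(\<integral>I. ?\<phi> I - ?A - I * ?B \<partial>imag_units_area) = 0"
    using int id by (simp add: integral_imag_units_area_ident one slice_mean_def)
  also have "(\<integral>I. I * ?\<phi> I - I * ?A + ?B \<partial>imag_units_area) = 0"
    using int' id by (simp add: integral_imag_units_area_ident one slice_moment_def)
  finally show ?thesis by simp
qed

text \<open>
  Hoelder's inequality for the kernel on each sphere of constant real part. Its \<open>q\<close>-th moment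
  \<open>2\<^sup>q \<cdot> 2 / (q + 2)\<close>, with \<open>q = p / (p - 1)\<close>, is exactly the \<open>q\<close>-th power of the bound, as
  \<open>2 / (q + 2) = (2 p - 2) / (3 p - 2)\<close>.
\<close>

lemma slice_average_powr_bound:
  assumes \<phi>: "\<phi> \<in> Lp_space 2" and p: "1 < p"
  shows "(\<integral>\<^sup>+x. ennreal (norm (slice_average \<phi> x) powr p) \<partial>bdry_measure) \<le>
    ennreal (slice_proj_bound p powr p) * (\<integral>\<^sup>+x. ennreal (norm (\<phi> x) powr p) \<partial>bdry_measure)"
proof -
  interpret S: prob_space imag_units_area by (rule prob_space_imag_units_area)
  have [measurable]: "\<phi> \<in> borel_measurable bdry_measure"
    using \<phi> by (simp add: Lp_space_2_iff)
  define q where "q = p / (p - 1)"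
  have q: "1 < q" "1 / p + 1 / q = 1"
    using p by (auto simp: q_def field_simps)
  have C: "0 < slice_proj_bound p"
    using p by (auto simp: slice_proj_bound_def)
  have Cq: "slice_proj_bound p powr q = 2 powr q * (2 / (q + 2))"
  proof -
    have e: "(p - 1) / p * q = 1"
      using p by (simp add: q_def)
    have "q + 2 = (3 * p - 2) / (p - 1)"
      using p by (simp add: q_def divide_simps)
    then have "2 / (q + 2) = (2 * p - 2) / (3 * p - 2)"
      by simp
    moreover have "slice_proj_bound p powr q = 2 powr q * ((2 * p - 2) / (3 * p - 2)) powr ((p - 1) / p * q)"
      using p unfolding slice_proj_bound_def by (subst powr_mult) (simp_all add: powr_powr)
    ultimately show ?thesis
      using p unfolding e by simp
  qed
  define N where "N t = (\<integral>\<^sup>+I. ennreal (norm (\<phi> (slice_point I t)) powr p) \<partial>imag_units_area)" for t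
  have m [measurable]: "(\<lambda>I. \<phi> (slice_point I t)) \<in> borel_measurable imag_units_area" for t
    by (rule measurable_compose_slice_point_fiber) simp
  have fiber: "ennreal (norm (slice_average \<phi> (slice_point J t)) powr p) \<le> ennreal (slice_proj_bound p powr p) * N t"
    if int: "integrable imag_units_area (\<lambda>I. \<phi> (slice_point I t))" and J: "J \<in> imag_units"
      and t: "0 < t" "t < pi" for J t
  proof (cases "N t")
    case top
    then show ?thesis using C by (simp add: ennreal_mult_top)
  next
    case (real n)
    have "(\<integral>\<^sup>+I. ennreal (norm (I + J) * norm (\<phi> (slice_point I t))) \<partial>imag_units_area) \<le>
        ennreal (slice_proj_bound p * n powr (1 / p))"
    proof (rule Holder_nn_integral [of _ _ _ _ _ q p])
      show "(\<integral>\<^sup>+I. ennreal (norm (I + J) powr q) \<partial>imag_units_area) \<le> ennreal (slice_proj_bound p powr q)"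
        using integral_norm_add_imag_units_powr [OF J, of q] q Cq
        by (subst nn_integral_eq_integral) auto
      show "(\<integral>\<^sup>+I. ennreal (norm (\<phi> (slice_point I t)) powr p) \<partial>imag_units_area) \<le> ennreal ((n powr (1 / p)) powr p)"
        using real p by (simp add: N_def powr_powr)
    qed (use p q C in auto)
    with norm_slice_average_le [OF int J t]
    have "ennreal (norm (slice_average \<phi> (slice_point J t))) \<le> ennreal (slice_proj_bound p * n powr (1 / p))"
      by (rule order_trans)
    then have "norm (slice_average \<phi> (slice_point J t)) \<le> slice_proj_bound p * n powr (1 / p)"
      using C by (subst (asm) ennreal_le_iff) auto
    then have "norm (slice_average \<phi> (slice_point J t)) powr p \<le> (slice_proj_bound p * n powr (1 / p)) powr p"
      using p by (intro powr_mono2) auto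
    also have "\<dots> = slice_proj_bound p powr p * n"
      using p real C by (simp add: powr_mult powr_powr)
    finally show ?thesis
      using real by (simp add: ennreal_mult [symmetric] ennreal_leI)
  qed
  have "(\<integral>\<^sup>+x. ennreal (norm (slice_average \<phi> x) powr p) \<partial>bdry_measure) =
     (\<integral>\<^sup>+t. \<integral>\<^sup>+J. ennreal (norm (slice_average \<phi> (slice_point J t)) powr p) \<partial>imag_units_area \<partial>half_circle)"
    by (rule nn_integral_bdry_measure_half) simp
  also have "\<dots> \<le> (\<integral>\<^sup>+t. ennreal (slice_proj_bound p powr p) * N t \<partial>half_circle)"
  proof (rule nn_integral_mono_AE)
    show "AE t in half_circle. (\<integral>\<^sup>+J. ennreal (norm (slice_average \<phi> (slice_point J t)) powr p) \<partial>imag_units_area) \<le>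
        ennreal (slice_proj_bound p powr p) * N t"
      using AE_half_circle_interior integral_bdry_measure_half(2) [OF Lp_space_2_integrable_self [OF \<phi>]]
    proof eventually_elim
      case (elim t)
      have "(\<integral>\<^sup>+J. ennreal (norm (slice_average \<phi> (slice_point J t)) powr p) \<partial>imag_units_area) \<le>
         (\<integral>\<^sup>+J. ennreal (slice_proj_bound p powr p) * N t \<partial>imag_units_area)"
        using elim by (intro nn_integral_mono fiber) auto
      then show ?case using S.emeasure_space_1 by simp
    qed
  qed
  also have "\<dots> = ennreal (slice_proj_bound p powr p) * (\<integral>\<^sup>+t. N t \<partial>half_circle)"
  proof (rule nn_integral_cmult)
    show "N \<in> borel_measurable half_circle"
      using S.borel_measurable_nn_integral_fst [OF measurable_compose_slice_point [of "\<lambda>x. ennreal (norm (\<phi> x) powr p)"]]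
      by (simp add: N_def [abs_def])
  qed
  also have "(\<integral>\<^sup>+t. N t \<partial>half_circle) = (\<integral>\<^sup>+x. ennreal (norm (\<phi> x) powr p) \<partial>bdry_measure)"
    unfolding N_def by (rule nn_integral_bdry_measure_half [symmetric]) simp
  finally show ?thesis .
qed

text \<open>
  Square integrability is the case \<open>p = 2\<close> of the preceding bound; orthogonality holds on almost
  every sphere of constant real part and is then integrated over the angle.
\<close>

lemma is_slice_proj_slice_average:
  assumes \<phi>: "\<phi> \<in> Lp_space 2"
  shows "is_slice_proj \<phi> (slice_average \<phi>)"
proof -
  have [measurable]: "\<phi> \<in> borel_measurable bdry_measure"
    using \<phi> by (simp add: Lp_space_2_iff)
  have "(\<integral>\<^sup>+x. ennreal (norm (slice_average \<phi> x) powr 2) \<partial>bdry_measure) \<le>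
    ennreal (slice_proj_bound 2 powr 2) * (\<integral>\<^sup>+x. ennreal (norm (\<phi> x) powr 2) \<partial>bdry_measure)"
    by (rule slice_average_powr_bound [OF \<phi>]) simp
  also have "\<dots> < \<infinity>"
    using \<phi> by (auto simp: Lp_space_2_iff integrable_iff_bounded ennreal_mult_less_top)
  finally have avg: "slice_average \<phi> \<in> Lp_space 2"
    by (auto simp: Lp_space_2_iff integrable_iff_bounded)
  then have slice: "slice_average \<phi> \<in> slice_Lp_space 2"
    using slice_function_slice_average
    by (auto simp: slice_Lp_space_def intro!: bexI [of _ "slice_average \<phi>"])
  have "L2_inner (\<lambda>x. \<phi> x - slice_average \<phi> x) g = 0" if g: "g \<in> slice_Lp_space 2" for g
  proof -
    have g2: "g \<in> Lp_space 2" using g by (rule slice_Lp_space_subset)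
    then have [measurable]: "g \<in> borel_measurable bdry_measure"
      by (simp add: Lp_space_2_iff)
    obtain f where [measurable]: "f \<in> borel_measurable bdry_measure" and f: "slice_function f"
      and gf: "AE x in bdry_measure. g x = f x"
      using g by (auto simp: slice_Lp_space_def)
    let ?d = "\<lambda>x. \<phi> x - slice_average \<phi> x"
    have "integrable bdry_measure (\<lambda>x. quat_cnj (g x) * ?d x)"
      by (rule Lp_space_2_integrable(3) [OF Lp_space_2_diff [OF \<phi> avg] g2])
    moreover have ae: "AE x in bdry_measure. quat_cnj (g x) * ?d x = quat_cnj (f x) * ?d x"
      using gf by eventually_elim simp
    ultimately have int: "integrable bdry_measure (\<lambda>x. quat_cnj (f x) * ?d x)"
      by (subst (asm) integrable_cong_AE [OF _ _ ae]) measurable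
    have "L2_inner ?d g = (\<integral>x. quat_cnj (f x) * ?d x \<partial>bdry_measure)"
      unfolding L2_inner_def by (rule integral_cong_AE [OF _ _ ae]) measurable
    also have "\<dots> = (\<integral>t. \<integral>I. quat_cnj (f (slice_point I t)) * ?d (slice_point I t) \<partial>imag_units_area \<partial>half_circle)"
      by (rule integral_bdry_measure_half(1) [OF int])
    also have "\<dots> = 0"
    proof (rule integral_eq_zero_AE)
      show "AE t in half_circle. (\<integral>I. quat_cnj (f (slice_point I t)) * ?d (slice_point I t) \<partial>imag_units_area) = 0"
        using AE_half_circle_interior integral_bdry_measure_half(2) [OF Lp_space_2_integrable_self [OF \<phi>]]
        by eventually_elim (rule slice_average_orthogonal_fiber [OF _ _ _ f]; simp)
    qed
    finally show ?thesis .
  qed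
  with slice show ?thesis by (simp add: is_slice_proj_def)
qed

lemma is_slice_proj_slice_proj:
  assumes "\<phi> \<in> Lp_space 2"
  shows "is_slice_proj \<phi> (slice_proj \<phi>)"
  using someI [of "is_slice_proj \<phi>", OF is_slice_proj_slice_average [OF assms]]
  unfolding slice_proj_def is_slice_proj_def .

lemma slice_proj_AE_eq_slice_average:
  assumes "\<phi> \<in> Lp_space 2"
  shows "AE x in bdry_measure. slice_proj \<phi> x = slice_average \<phi> x"
  by (rule is_slice_proj_unique [OF assms is_slice_proj_slice_proj [OF assms] is_slice_proj_slice_average [OF assms]])

section \<open>Testing against bounded functions\<close>

lemma Lp_norm_bounded:
  assumes [measurable]: "f \<in> borel_measurable bdry_measure" and B: "\<And>x. x \<in> sphere 0 1 \<Longrightarrow> norm (f x) \<le> B"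
    and p: "1 \<le> p"
  shows "Lp_norm p f \<le> ennreal B"
  using p
proof (cases rule: exponent_cases)
  case infinite
  have "AE x in bdry_measure. ennreal (norm (f x)) \<le> ennreal B"
    using B by (intro AE_I2) (auto intro!: ennreal_leI)
  then show ?thesis
    unfolding infinite by (subst Lp_norm_infinity_le_iff) auto
next
  case (finite r)
  interpret prob_space bdry_measure by (rule prob_space_bdry_measure)
  have "norm (1 :: quaternion) = 1" by simp
  then have "0 \<le> B" using B [of 1] by (simp add: order_trans [OF norm_ge_zero])
  moreover have "(\<integral>\<^sup>+x. ennreal (norm (f x) powr r) \<partial>bdry_measure) \<le> (\<integral>\<^sup>+x. ennreal (B powr r) \<partial>bdry_measure)"
    using B finite by (intro nn_integral_mono ennreal_leI powr_mono2) auto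
  moreover have "(\<integral>\<^sup>+x. ennreal (B powr r) \<partial>bdry_measure) = ennreal (B powr r)"
    using emeasure_space_1 by simp
  ultimately show ?thesis
    using Lp_norm_le_iff [OF finite(2), of B f] finite(1) by simp
qed

lemma Lp_space_bounded:
  assumes "f \<in> borel_measurable bdry_measure" "\<And>x. x \<in> sphere 0 1 \<Longrightarrow> norm (f x) \<le> B" "1 \<le> p"
  shows "f \<in> Lp_space p"
  using Lp_norm_bounded [OF assms] assms(1) by (auto simp: Lp_space_def intro: le_less_trans)

lemma inner_sgn_self: "x \<bullet> sgn x = norm x" for x :: "'a :: real_inner"
  by (cases "x = 0") (simp_all add: sgn_div_norm power2_norm_eq_inner [symmetric] power2_eq_square)

lemma borel_measurable_sgn_quat [measurable (raw)]:
  fixes f :: "'a \<Rightarrow> quaternion"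
  shows "f \<in> borel_measurable M \<Longrightarrow> (\<lambda>x. sgn (f x)) \<in> borel_measurable M"
  unfolding sgn_div_norm by (intro borel_measurable_scaleR borel_measurable_inverse) simp_all

text \<open>
  The converse of Hoelder's inequality. The test functions are the usual extremal ones: the sign of
  \<open>h\<close> restricted to \<open>|h| > K\<close> for \<open>p = \<infinity>\<close>, the sign of \<open>h\<close> for \<open>p = 1\<close>, and \<open>|h|\<^sup>p\<^sup>-\<^sup>1\<close> times the sign of \<open>h\<close>
  otherwise. In the last case \<open>h\<close> need not be bounded or have finite norm, so the test function is cut
  off where \<open>|h| > n\<close>, and \<open>n\<close> tends to infinity.
\<close>

lemma Lp_norm_le_of_dual:
  assumes pq: "1 \<le> p" "1 \<le> q" "1 / p + 1 / q = 1"
    and h: "h \<in> Lp_space 2" and K: "0 \<le> K"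
    and dual: "\<And>\<psi> B. \<psi> \<in> borel_measurable bdry_measure \<Longrightarrow> (\<And>x. norm (\<psi> x) \<le> B) \<Longrightarrow>
      ennreal (\<integral>x. h x \<bullet> \<psi> x \<partial>bdry_measure) \<le> ennreal K * Lp_norm q \<psi>"
  shows "Lp_norm p h \<le> ennreal K"
proof -
  interpret prob_space bdry_measure by (rule prob_space_bdry_measure)
  have [measurable]: "h \<in> borel_measurable bdry_measure" and h1: "integrable bdry_measure (\<lambda>x. norm (h x))"
    using h Lp_space_2_integrable_self [OF h] by (auto simp: Lp_space_2_iff)
  show ?thesis
    using pq
  proof (cases rule: conjugate_exponent_cases)
    case 1
    define E where "E = {x. K < norm (h x)}"
    have E [measurable]: "Measurable.pred bdry_measure (\<lambda>x. x \<in> E)"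
      unfolding E_def by simp
    define \<psi> where "\<psi> x = indicator E x *\<^sub>R sgn (h x)" for x
    have [measurable]: "\<psi> \<in> borel_measurable bdry_measure"
      unfolding \<psi>_def indicator_def by measurable
    have i1: "integrable bdry_measure (\<lambda>x. indicator E x * norm (h x))"
      by (rule Bochner_Integration.integrable_bound [OF h1]) (measurable, auto simp: indicator_def)
    have i2: "integrable bdry_measure (\<lambda>x. indicator E x :: real)"
      by (rule integrable_const_bound [of _ 1]) (auto simp: indicator_def)
    have "Lp_norm 1 \<psi> \<le> ennreal (\<integral>x. indicator E x \<partial>bdry_measure)"
    proof -
      have "(\<integral>\<^sup>+x. ennreal (norm (\<psi> x)) \<partial>bdry_measure) \<le> (\<integral>\<^sup>+x. ennreal (indicator E x) \<partial>bdry_measure)"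
        by (intro nn_integral_mono ennreal_leI) (auto simp: \<psi>_def indicator_def norm_sgn)
      also have "\<dots> = ennreal (\<integral>x. indicator E x \<partial>bdry_measure)"
        by (rule nn_integral_eq_integral [OF i2]) simp
      finally show ?thesis
        using Lp_norm_le_iff [of 1 "\<integral>x. indicator E x \<partial>bdry_measure" \<psi>] by simp
    qed
    moreover have "ennreal (\<integral>x. h x \<bullet> \<psi> x \<partial>bdry_measure) \<le> ennreal K * Lp_norm 1 \<psi>"
      unfolding 1(2) [symmetric] by (rule dual [of _ 1]) (auto simp: \<psi>_def indicator_def norm_sgn)
    moreover have "(\<integral>x. h x \<bullet> \<psi> x \<partial>bdry_measure) = (\<integral>x. indicator E x * norm (h x) \<partial>bdry_measure)"
      by (simp add: \<psi>_def inner_sgn_self)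
    ultimately have "ennreal (\<integral>x. indicator E x * norm (h x) \<partial>bdry_measure) \<le>
       ennreal K * ennreal (\<integral>x. indicator E x \<partial>bdry_measure)"
      by (metis mult_left_mono order_trans zero_le)
    then have "(\<integral>x. indicator E x * norm (h x) \<partial>bdry_measure) \<le> K * (\<integral>x. indicator E x \<partial>bdry_measure)"
      using K by (subst (asm) ennreal_mult [symmetric]) (auto simp: ennreal_le_iff)
    then have "(\<integral>x. indicator E x * norm (h x) - K * indicator E x \<partial>bdry_measure) \<le> 0"
      using i1 i2 by (subst Bochner_Integration.integral_diff) auto
    moreover have nonneg: "0 \<le> indicator E x * norm (h x) - K * indicator E x" for x
      by (auto simp: indicator_def E_def)
    ultimately have "(\<integral>x. indicator E x * norm (h x) - K * indicator E x \<partial>bdry_measure) = 0"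
      by (intro antisym integral_nonneg) auto
    then have "AE x in bdry_measure. indicator E x * norm (h x) - K * indicator E x = 0"
      using i1 i2 nonneg by (subst (asm) integral_nonneg_eq_0_iff_AE) auto
    then have "AE x in bdry_measure. ennreal (norm (h x)) \<le> ennreal K"
      by eventually_elim (auto simp: E_def indicator_def intro!: ennreal_leI split: if_splits)
    then show ?thesis
      unfolding 1(1) by (subst Lp_norm_infinity_le_iff) auto
  next
    case 2
    have "ennreal (\<integral>x. h x \<bullet> sgn (h x) \<partial>bdry_measure) \<le> ennreal K * Lp_norm q (\<lambda>x. sgn (h x))"
      by (rule dual [of _ 1]) (auto simp: norm_sgn)
    also have "Lp_norm q (\<lambda>x. sgn (h x)) \<le> ennreal 1"
      by (rule Lp_norm_bounded [OF _ _ pq(2)]) (auto simp: norm_sgn)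
    finally have "ennreal (\<integral>x. norm (h x) \<partial>bdry_measure) \<le> ennreal K"
      by (simp add: inner_sgn_self mult_left_mono)
    moreover have "(\<integral>\<^sup>+x. ennreal (norm (h x)) \<partial>bdry_measure) = ennreal (\<integral>x. norm (h x) \<partial>bdry_measure)"
      by (rule nn_integral_eq_integral [OF h1]) simp
    ultimately show ?thesis
      using Lp_norm_le_iff [of 1 K h] K 2 by simp
  next
    case (3 r s)
    have rs: "(r - 1) * s = r"
      using 3 by (simp add: field_simps)
    define T where "T n x = (if norm (h x) \<le> real n then norm (h x) powr r else 0)" for n x
    have [measurable]: "T n \<in> borel_measurable bdry_measure" for n
      unfolding T_def by measurable
    have T: "(\<integral>\<^sup>+x. ennreal (T n x) \<partial>bdry_measure) \<le> ennreal (K powr r)" for n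
    proof -
      have T_nonneg: "0 \<le> T n x" for x by (simp add: T_def)
      have int: "integrable bdry_measure (T n)"
      proof (rule integrable_const_bound)
        have "T n x \<le> real n powr r" for x
          using 3 by (auto simp: T_def intro!: powr_mono2)
        then show "AE x in bdry_measure. norm (T n x) \<le> real n powr r"
          using T_nonneg by simp
      qed simp
      define x where "x = (\<integral>x. T n x \<partial>bdry_measure)"
      have x: "0 \<le> x" "(\<integral>\<^sup>+x. ennreal (T n x) \<partial>bdry_measure) = ennreal x"
        unfolding x_def using T_nonneg
        by (auto intro!: integral_nonneg nn_integral_eq_integral int)
      define \<psi> where "\<psi> x = (if norm (h x) \<le> real n then (norm (h x) powr (r - 1)) *\<^sub>R sgn (h x) else 0)" for x
      have [measurable]: "\<psi> \<in> borel_measurable bdry_measure"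
        unfolding \<psi>_def by measurable
      have norm_\<psi>: "norm (\<psi> x) = (if norm (h x) \<le> real n then norm (h x) powr (r - 1) else 0)" for x
        by (simp add: \<psi>_def norm_sgn)
      have "ennreal (\<integral>x. h x \<bullet> \<psi> x \<partial>bdry_measure) \<le> ennreal K * Lp_norm q \<psi>"
        by (rule dual [of _ "real n powr (r - 1)"]) (use 3 in \<open>auto simp: norm_\<psi> intro!: powr_mono2\<close>)
      also have "h x \<bullet> \<psi> x = T n x" for x
        using 3 by (cases "h x = 0") (auto simp: \<psi>_def T_def inner_sgn_self powr_diff)
      then have "(\<integral>x. h x \<bullet> \<psi> x \<partial>bdry_measure) = x"
        by (simp add: x_def)
      also have "Lp_norm q \<psi> \<le> ennreal (x powr (1 / s))"
      proof -
        have "norm (\<psi> x) powr s = T n x" for x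
          using 3 by (simp add: norm_\<psi> T_def powr_powr rs)
        then show ?thesis
          using 3 x Lp_norm_le_iff [of s "x powr (1 / s)" \<psi>] by (simp add: powr_powr)
      qed
      finally have "ennreal x \<le> ennreal (K * x powr (1 / s))"
        using K by (simp add: mult_left_mono ennreal_mult)
      then have le: "x \<le> K * x powr (1 / s)"
        using K by (subst (asm) ennreal_le_iff) auto
      have "x \<le> K powr r"
      proof (cases "x = 0")
        \<comment> \<open>dividing \<open>x \<le> K x\<^sup>1\<^sup>/\<^sup>s\<close> by \<open>x\<^sup>1\<^sup>/\<^sup>s\<close> is possible since the truncated integral \<open>x\<close> is finite\<close>
        case False
        with x have "0 < x" by simp
        have "x = x powr (1 / r) * x powr (1 / s)"
          using \<open>0 < x\<close> 3 by (simp flip: powr_add)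
        with le have "x powr (1 / r) * x powr (1 / s) \<le> K * x powr (1 / s)"
          by simp
        then have "x powr (1 / r) \<le> K"
          using \<open>0 < x\<close> by simp
        from powr_mono2 [OF _ _ this, of r] show ?thesis
          using 3 \<open>0 < x\<close> by (simp add: powr_powr)
      qed (use K in simp)
      then show ?thesis using x by (simp add: ennreal_leI)
    qed
    have "(\<lambda>n. \<integral>\<^sup>+x. ennreal (T n x) \<partial>bdry_measure) \<longlonglongrightarrow> (\<integral>\<^sup>+x. ennreal (norm (h x) powr r) \<partial>bdry_measure)"
    proof (rule nn_integral_LIMSEQ)
      show "incseq (\<lambda>n x. ennreal (T n x))"
        by (auto simp: incseq_def le_fun_def T_def intro!: ennreal_leI)
      fix x
      obtain n where n: "norm (h x) \<le> real n" using real_arch_simple by blast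
      show "(\<lambda>n. ennreal (T n x)) \<longlonglongrightarrow> ennreal (norm (h x) powr r)"
        by (rule tendsto_eventually)
          (use n in \<open>auto simp: eventually_sequentially T_def intro!: exI [of _ n]\<close>)
    qed simp
    from LIMSEQ_le_const2 [OF this] have "(\<integral>\<^sup>+x. ennreal (norm (h x) powr r) \<partial>bdry_measure) \<le> ennreal (K powr r)"
      using T by blast
    then show ?thesis
      using 3 Lp_norm_le_iff [of r K h] K by simp
  qed
qed

section \<open>The operator norms\<close>

lemma Lp_norm_slice_proj:
  assumes "\<phi> \<in> Lp_space 2"
  shows "Lp_norm p (slice_proj \<phi>) = Lp_norm p (slice_average \<phi>)"
proof (rule Lp_norm_cong_AE [OF _ _ slice_proj_AE_eq_slice_average [OF assms]])
  have "slice_proj \<phi> \<in> Lp_space 2"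
    using is_slice_proj_slice_proj [OF assms] by (auto simp: is_slice_proj_def dest: slice_Lp_space_subset)
  then show "slice_proj \<phi> \<in> borel_measurable bdry_measure"
    by (simp add: Lp_space_2_iff)
  show "slice_average \<phi> \<in> borel_measurable bdry_measure"
    using assms by (intro borel_measurable_slice_average) (simp add: Lp_space_2_iff)
qed

lemma Lp_norm_pos_finite:
  assumes "\<phi> \<in> Lp_space p" "1 \<le> p" "\<not> (AE x in bdry_measure. \<phi> x = 0)"
  shows "Lp_norm p \<phi> \<noteq> 0" "Lp_norm p \<phi> \<noteq> \<top>"
  using assms Lp_norm_eq_0D [of \<phi> p] by (auto simp: Lp_space_def)

lemma slice_proj_norm_leI:
  assumes p: "1 \<le> p" and C: "\<And>\<phi>. \<phi> \<in> Lp_space 2 \<Longrightarrow> \<phi> \<in> Lp_space p \<Longrightarrow> Lp_norm p (slice_proj \<phi>) \<le> C * Lp_norm p \<phi>"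
  shows "slice_proj_norm p \<le> C"
  unfolding slice_proj_norm_def
proof (rule SUP_least)
  fix \<phi> assume "\<phi> \<in> {\<phi> \<in> Lp_space 2 \<inter> Lp_space p. \<not> (AE x in bdry_measure. \<phi> x = 0)}"
  then have \<phi>: "\<phi> \<in> Lp_space 2" "\<phi> \<in> Lp_space p" "\<not> (AE x in bdry_measure. \<phi> x = 0)"
    by auto
  have "Lp_norm p (slice_proj \<phi>) / Lp_norm p \<phi> \<le> C * Lp_norm p \<phi> / Lp_norm p \<phi>"
    by (rule divide_right_mono_ennreal [OF C [OF \<phi>(1,2)]])
  also have "\<dots> = C"
    by (rule mult_divide_eq_ennreal) (use Lp_norm_pos_finite [OF \<phi>(2) p \<phi>(3)] in auto)
  finally show "Lp_norm p (slice_proj \<phi>) / Lp_norm p \<phi> \<le> C" .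
qed

lemma Lp_norm_slice_proj_le:
  assumes p: "1 \<le> p" and \<phi>: "\<phi> \<in> Lp_space 2" "\<phi> \<in> Lp_space p" "\<not> (AE x in bdry_measure. \<phi> x = 0)"
  shows "Lp_norm p (slice_proj \<phi>) \<le> slice_proj_norm p * Lp_norm p \<phi>"
proof -
  have "Lp_norm p (slice_proj \<phi>) = Lp_norm p (slice_proj \<phi>) / Lp_norm p \<phi> * Lp_norm p \<phi>"
    using Lp_norm_pos_finite [OF \<phi>(2) p \<phi>(3)] by (simp add: ennreal_divide_times ennreal_divide_self ennreal_times_divide mult_divide_eq_ennreal)
  also have "\<dots> \<le> slice_proj_norm p * Lp_norm p \<phi>"
    unfolding slice_proj_norm_def by (intro mult_right_mono SUP_upper) (use \<phi> in auto)
  finally show ?thesis .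
qed

text \<open>
  For bounded \<open>\<psi>\<close> the pairing of \<open>\<Pi>\<phi>\<close> with \<open>\<psi>\<close> equals that of \<open>\<phi>\<close> with \<open>\<Pi>\<psi>\<close>, which Hoelder's
  inequality bounds by \<open>\<parallel>\<phi>\<parallel>\<^sub>p \<parallel>\<Pi>\<parallel>\<^sub>q \<parallel>\<psi>\<parallel>\<^sub>q\<close>. If \<open>\<Pi>\<close> is unbounded for the exponent \<open>q\<close> there is nothing to prove.
\<close>

lemma slice_proj_norm_conjugate_le:
  assumes pq: "1 \<le> p" "1 \<le> q" "1 / p + 1 / q = 1"
  shows "slice_proj_norm p \<le> slice_proj_norm q"
proof (cases "slice_proj_norm q")
  case (real n)
  show ?thesis
  proof (rule slice_proj_norm_leI [OF pq(1)])
    fix \<phi> assume \<phi>: "\<phi> \<in> Lp_space 2" "\<phi> \<in> Lp_space p"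
    obtain c where c: "0 \<le> c" "Lp_norm p \<phi> = ennreal c"
      using \<phi>(2) by (cases "Lp_norm p \<phi>") (auto simp: Lp_space_def)
    note proj = is_slice_proj_slice_proj
    have proj2: "slice_proj \<psi> \<in> Lp_space 2" if "\<psi> \<in> Lp_space 2" for \<psi>
      using proj [OF that] by (auto simp: is_slice_proj_def dest: slice_Lp_space_subset)
    have "Lp_norm p (slice_proj \<phi>) \<le> ennreal (n * c)"
    proof (rule Lp_norm_le_of_dual [OF pq proj2 [OF \<phi>(1)]])
      show "0 \<le> n * c" using real c by simp
      fix \<psi> :: "quaternion \<Rightarrow> quaternion" and B assume [measurable]: "\<psi> \<in> borel_measurable bdry_measure" and B: "\<And>x. norm (\<psi> x) \<le> (B :: real)"
      have \<psi>: "\<psi> \<in> Lp_space 2" "\<psi> \<in> Lp_space q"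
        using Lp_space_bounded [OF _ B] pq(2) by auto
      show "ennreal (\<integral>x. slice_proj \<phi> x \<bullet> \<psi> x \<partial>bdry_measure) \<le> ennreal (n * c) * Lp_norm q \<psi>"
      proof (cases "AE x in bdry_measure. \<psi> x = 0")
        case True
        then have "AE x in bdry_measure. slice_proj \<phi> x \<bullet> \<psi> x = 0"
          by eventually_elim simp
        then have "(\<integral>x. slice_proj \<phi> x \<bullet> \<psi> x \<partial>bdry_measure) = 0"
          by (rule integral_eq_zero_AE)
        then show ?thesis by simp
      next
        case False
        have le: "Lp_norm q (slice_proj \<psi>) \<le> ennreal n * Lp_norm q \<psi>"
          using Lp_norm_slice_proj_le [OF pq(2) \<psi> False] real by simp
        also have "\<dots> < \<infinity>"
          using \<psi>(2) by (auto simp: Lp_space_def ennreal_mult_less_top)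
        finally have \<psi>q: "slice_proj \<psi> \<in> Lp_space q"
          using proj2 [OF \<psi>(1)] by (simp add: Lp_space_def)
        have "ennreal (\<integral>x. slice_proj \<phi> x \<bullet> \<psi> x \<partial>bdry_measure) = ennreal (\<integral>x. \<phi> x \<bullet> slice_proj \<psi> x \<partial>bdry_measure)"
          by (simp only: is_slice_proj_symmetric [OF \<phi>(1) proj [OF \<phi>(1)] \<psi>(1) proj [OF \<psi>(1)]])
        also have "\<dots> \<le> ennreal (norm (\<integral>x. \<phi> x \<bullet> slice_proj \<psi> x \<partial>bdry_measure))"
          by (rule ennreal_leI) simp
        also have "\<dots> \<le> (\<integral>\<^sup>+x. ennreal (norm (\<phi> x \<bullet> slice_proj \<psi> x)) \<partial>bdry_measure)"
          by (rule integral_norm_bound_ennreal) (rule Lp_space_2_integrable(2) [OF \<phi>(1) proj2 [OF \<psi>(1)]])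
        also have "\<dots> \<le> (\<integral>\<^sup>+x. ennreal (norm (\<phi> x) * norm (slice_proj \<psi> x)) \<partial>bdry_measure)"
          by (intro nn_integral_mono ennreal_leI) (use Cauchy_Schwarz_ineq2 in auto)
        also have "\<dots> \<le> Lp_norm p \<phi> * Lp_norm q (slice_proj \<psi>)"
          by (rule Holder_Lp_norm [OF pq \<phi>(2) \<psi>q])
        also have "\<dots> \<le> Lp_norm p \<phi> * (ennreal n * Lp_norm q \<psi>)"
          by (rule mult_left_mono [OF le]) simp
        also have "\<dots> = ennreal (n * c) * Lp_norm q \<psi>"
          using real(1) c by (simp add: ennreal_mult mult_ac)
        finally show ?thesis .
      qed
    qed
    then show "Lp_norm p (slice_proj \<phi>) \<le> slice_proj_norm q * Lp_norm p \<phi>"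
      using real c by (simp add: ennreal_mult)
  qed
qed simp

text \<open>
  Here \<open>\<parallel>\<Pi>\<phi>\<parallel>\<^sup>2\<close> is the inner product of \<open>\<phi>\<close> and \<open>\<Pi>\<phi>\<close>, which is at most the mean of \<open>\<parallel>\<phi>\<parallel>\<^sup>2\<close> and \<open>\<parallel>\<Pi>\<phi>\<parallel>\<^sup>2\<close>.
\<close>

lemma slice_proj_norm_2_le: "slice_proj_norm 2 \<le> 1"
proof (rule slice_proj_norm_leI)
  fix \<phi> assume \<phi>: "\<phi> \<in> Lp_space 2"
  let ?\<psi> = "slice_proj \<phi>"
  have s: "?\<psi> \<in> slice_Lp_space 2"
    using is_slice_proj_slice_proj [OF \<phi>] by (simp add: is_slice_proj_def)
  then have \<psi>: "?\<psi> \<in> Lp_space 2" by (rule slice_Lp_space_subset)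
  have i: "integrable bdry_measure (\<lambda>x. (norm (\<phi> x))\<^sup>2)" "integrable bdry_measure (\<lambda>x. (norm (?\<psi> x))\<^sup>2)"
    using \<phi> \<psi> by (auto simp: Lp_space_2_iff)
  have "(\<integral>x. (norm (?\<psi> x))\<^sup>2 \<partial>bdry_measure) = (\<integral>x. \<phi> x \<bullet> ?\<psi> x \<partial>bdry_measure)"
    using is_slice_proj_inner [OF \<phi> is_slice_proj_slice_proj [OF \<phi>] s] by (simp add: power2_norm_eq_inner)
  also have "\<dots> \<le> (\<integral>x. ((norm (\<phi> x))\<^sup>2 + (norm (?\<psi> x))\<^sup>2) / 2 \<partial>bdry_measure)"
  proof (intro integral_mono Lp_space_2_integrable(2) \<phi> \<psi>)
    fix x
    have "\<phi> x \<bullet> ?\<psi> x \<le> norm (\<phi> x) * norm (?\<psi> x)"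
      by (rule norm_cauchy_schwarz)
    then show "\<phi> x \<bullet> ?\<psi> x \<le> ((norm (\<phi> x))\<^sup>2 + (norm (?\<psi> x))\<^sup>2) / 2"
      using sum_squares_bound [of "norm (\<phi> x)" "norm (?\<psi> x)"] by simp
  qed (use i in auto)
  finally have le: "(\<integral>x. (norm (?\<psi> x))\<^sup>2 \<partial>bdry_measure) \<le> (\<integral>x. (norm (\<phi> x))\<^sup>2 \<partial>bdry_measure)"
    using i by simp
  obtain c where c: "0 \<le> c" "Lp_norm 2 \<phi> = ennreal c"
    using \<phi> by (cases "Lp_norm 2 \<phi>") (auto simp: Lp_space_def)
  have "(\<integral>\<^sup>+x. ennreal ((norm (?\<psi> x))\<^sup>2) \<partial>bdry_measure) \<le> (\<integral>\<^sup>+x. ennreal ((norm (\<phi> x))\<^sup>2) \<partial>bdry_measure)"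
    using le i by (simp add: nn_integral_eq_integral ennreal_leI)
  also have "\<dots> \<le> ennreal (c powr 2)"
    using Lp_norm_le_iff [of 2 c \<phi>] c by simp
  finally show "Lp_norm 2 ?\<psi> \<le> 1 * Lp_norm 2 \<phi>"
    using Lp_norm_le_iff [of 2 c ?\<psi>] c by simp
qed simp

lemma slice_function_const: "slice_function (\<lambda>x. c)"
  by (simp add: slice_function_def flip: scaleR_2)

text \<open>
  Constants are slice functions, so the constant \<open>1\<close> is its own projection.
\<close>

lemma slice_proj_norm_ge_1:
  assumes p: "1 \<le> p"
  shows "1 \<le> slice_proj_norm p"
proof -
  interpret prob_space bdry_measure by (rule prob_space_bdry_measure)
  let ?one = "\<lambda>x. 1 :: quaternion"
  have L: "?one \<in> Lp_space r" if "1 \<le> r" for r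
    by (rule Lp_space_bounded [of _ 1]) (use that in auto)
  have L2: "?one \<in> Lp_space 2" by (rule L) simp
  then have "is_slice_proj ?one ?one"
    using slice_function_const [of 1]
    by (auto simp: is_slice_proj_def slice_Lp_space_def L2_inner_def intro!: bexI [of _ ?one])
  from is_slice_proj_unique [OF L2 is_slice_proj_slice_proj [OF L2] this]
  have "AE x in bdry_measure. slice_proj ?one x = 1" .
  moreover have "slice_proj ?one \<in> borel_measurable bdry_measure"
    using is_slice_proj_slice_proj [OF L2]
    by (auto simp: is_slice_proj_def slice_Lp_space_def Lp_space_def)
  ultimately have eq: "Lp_norm p (slice_proj ?one) = Lp_norm p ?one"
    by (intro Lp_norm_cong_AE) auto
  have nz: "\<not> (AE x in bdry_measure. ?one x = 0)"
    using AE_contr [of "\<lambda>x. False"] by auto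
  have "1 = Lp_norm p (slice_proj ?one) / Lp_norm p ?one"
    unfolding eq using Lp_norm_pos_finite [OF L [OF p] p nz] by (simp add: ennreal_divide_self less_top)
  also have "\<dots> \<le> slice_proj_norm p"
    unfolding slice_proj_norm_def by (rule SUP_upper) (use L2 L [OF p] nz in auto)
  finally show ?thesis .
qed

lemma slice_proj_norm_le_bound:
  assumes p: "1 < p"
  shows "slice_proj_norm (ennreal p) \<le> ennreal (slice_proj_bound p)"
proof (rule slice_proj_norm_leI)
  show "1 \<le> ennreal p" using p by simp
  fix \<phi> assume \<phi>: "\<phi> \<in> Lp_space 2" "\<phi> \<in> Lp_space (ennreal p)"
  obtain c where c: "0 \<le> c" "Lp_norm (ennreal p) \<phi> = ennreal c"
    using \<phi>(2) by (cases "Lp_norm (ennreal p) \<phi>") (auto simp: Lp_space_def)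
  have C: "0 \<le> slice_proj_bound p"
    by (simp add: slice_proj_bound_def)
  have "(\<integral>\<^sup>+x. ennreal (norm (slice_average \<phi> x) powr p) \<partial>bdry_measure) \<le>
      ennreal (slice_proj_bound p powr p) * (\<integral>\<^sup>+x. ennreal (norm (\<phi> x) powr p) \<partial>bdry_measure)"
    by (rule slice_average_powr_bound [OF \<phi>(1) p])
  also have "\<dots> \<le> ennreal (slice_proj_bound p powr p) * ennreal (c powr p)"
    using Lp_norm_le_iff [of p c \<phi>] c p by (intro mult_left_mono) auto
  also have "\<dots> = ennreal ((slice_proj_bound p * c) powr p)"
    using C c by (simp add: powr_mult ennreal_mult)
  finally have "Lp_norm (ennreal p) (slice_average \<phi>) \<le> ennreal (slice_proj_bound p * c)"
    using Lp_norm_le_iff [of p "slice_proj_bound p * c" "slice_average \<phi>"] C c p by simp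
  then show "Lp_norm (ennreal p) (slice_proj \<phi>) \<le> ennreal (slice_proj_bound p) * Lp_norm (ennreal p) \<phi>"
    using C c by (simp add: Lp_norm_slice_proj [OF \<phi>(1)] ennreal_mult)
qed

lemma nn_integral_norm_add_imag_units:
  assumes "J \<in> imag_units"
  shows "(\<integral>\<^sup>+I. ennreal (norm (I + J)) \<partial>imag_units_area) = ennreal (4 / 3)"
  using integral_norm_add_imag_units_powr [OF assms, of 1] by (subst nn_integral_eq_integral) auto

text \<open>
  On each sphere of constant real part the modulus of the kernel has integral \<open>4/3\<close>, for every \<open>J\<close>.
\<close>

lemma slice_proj_norm_infinity_le: "slice_proj_norm \<infinity> \<le> ennreal (4 / 3)"
proof (rule slice_proj_norm_leI)
  fix \<phi> assume \<phi>: "\<phi> \<in> Lp_space 2" "\<phi> \<in> Lp_space \<infinity>"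
  have [measurable]: "\<phi> \<in> borel_measurable bdry_measure"
    using \<phi> by (simp add: Lp_space_2_iff)
  let ?c = "Lp_norm \<infinity> \<phi>"
  have "AE x in bdry_measure. ennreal (norm (\<phi> x)) \<le> ?c"
    using Lp_norm_infinity_le_iff [of \<phi> ?c] by simp
  from AE_bdry_measureD [OF this]
  have "AE t in half_circle. AE J in imag_units_area. ennreal (norm (slice_average \<phi> (slice_point J t))) \<le> ennreal (4 / 3) * ?c"
    using AE_half_circle_interior integral_bdry_measure_half(2) [OF Lp_space_2_integrable_self [OF \<phi>(1)]]
  proof eventually_elim
    case (elim t)
    show ?case
    proof (intro AE_I2)
      fix J assume "J \<in> space imag_units_area"
      then have J: "J \<in> imag_units" by simp
      have "ennreal (norm (slice_average \<phi> (slice_point J t))) \<le>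
         (\<integral>\<^sup>+I. ennreal (norm (I + J) * norm (\<phi> (slice_point I t))) \<partial>imag_units_area)"
        using elim by (intro norm_slice_average_le J) auto
      also have "\<dots> \<le> (\<integral>\<^sup>+I. ennreal (norm (I + J)) * ?c \<partial>imag_units_area)"
        using elim(1) by (intro nn_integral_mono_AE) (auto simp: ennreal_mult intro!: mult_left_mono)
      also have "\<dots> = ennreal (4 / 3) * ?c"
        by (subst nn_integral_multc) (simp_all add: nn_integral_norm_add_imag_units [OF J])
      finally show "ennreal (norm (slice_average \<phi> (slice_point J t))) \<le> ennreal (4 / 3) * ?c" .
    qed
  qed
  then have "AE x in bdry_measure. ennreal (norm (slice_average \<phi> x)) \<le> ennreal (4 / 3) * ?c"
    by (intro AE_bdry_measureI) measurable
  then show "Lp_norm \<infinity> (slice_proj \<phi>) \<le> ennreal (4 / 3) * ?c"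
    unfolding Lp_norm_slice_proj [OF \<phi>(1)] by (subst Lp_norm_infinity_le_iff) auto
qed simp

text \<open>
  Spherical caps have positive area: integrate the positive part of \<open>c - s\<close> by the hat-box theorem.
\<close>

lemma AE_imag_units_area_inner_le:
  assumes K: "K \<in> imag_units" and ae: "AE J in imag_units_area. J \<bullet> K \<le> s"
  shows "1 \<le> s"
proof -
  let ?h = "\<lambda>c. max 0 (c - s)"
  have h: "continuous_on {-1..1} ?h" by (intro continuous_intros)
  have "AE J in imag_units_area. ?h (J \<bullet> K) = 0"
    using ae by eventually_elim simp
  then have "(\<integral>J. ?h (J \<bullet> K) \<partial>imag_units_area) = 0"
    by (rule integral_eq_zero_AE)
  then have "integral {-1..1} ?h = 0"
    using integral_zonal_imag_units [OF h K] by simp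
  then have "\<forall>c\<in>{-1..1}. ?h c = 0"
    using integral_eq_0_iff [OF h] by simp
  then have "?h 1 = 0" by (rule bspec) simp
  then show ?thesis by (simp add: max_def split: if_splits)
qed

text \<open>
  The extremal function is the unit vector in the direction \<open>I + k\<close>. As \<open>(I + k)\<^sup>2 = - |I + k|\<^sup>2\<close>, the kernel
  \<open>1 - k I = - k (I + k)\<close> times this vector is \<open>|I + k| k\<close>, so no cancellation occurs at \<open>J = k\<close> and the
  average there has modulus \<open>4/3\<close>. If the norm were \<open>m < 4/3\<close>, then \<open>|A + J B| \<le> m\<close> for almost all \<open>J\<close>,
  and almost all \<open>J\<close> would stay at a positive distance from \<open>k\<close>, which spherical caps exclude.
\<close>

lemma slice_proj_norm_infinity_ge: "ennreal (4 / 3) \<le> slice_proj_norm \<infinity>"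
proof (rule ccontr)
  assume "\<not> ennreal (4 / 3) \<le> slice_proj_norm \<infinity>"
  then have less: "slice_proj_norm \<infinity> < ennreal (4 / 3)" by simp
  then obtain m where m: "0 \<le> m" "slice_proj_norm \<infinity> = ennreal m"
    by (cases "slice_proj_norm \<infinity>") auto
  with less have m43: "m < 4 / 3" by (simp add: ennreal_less_iff)
  define k where "k = Quat 0 0 0 1"
  have k: "k \<in> imag_units" by (simp add: k_def imag_units_iff)
  define \<phi> where "\<phi> x = sgn (sgn (x - of_real (Re_quat x)) + k)" for x
  have \<phi>_slice: "\<phi> (slice_point I t) = sgn (I + k)" if "I \<in> imag_units" "0 < t" "t < pi" for I t
  proof -
    have "slice_point I t - of_real (cos t) = sin t *\<^sub>R I"
      by (simp add: slice_point_def of_real_def)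
    then show ?thesis
      using that sin_gt_zero [of t] norm_imag_unit [of I]
      by (simp add: \<phi>_def Re_quat_slice_point sgn_scaleR sgn_div_norm [of I])
  qed
  have "(\<lambda>x. sgn (sgn (x - of_real (x \<bullet> 1)) + k)) \<in> borel_measurable bdry_measure"
    unfolding of_real_def by measurable
  then have \<phi>m [measurable]: "\<phi> \<in> borel_measurable bdry_measure"
    unfolding \<phi>_def [abs_def] by (simp add: inner_quaternion_def)
  have \<phi>1: "norm (\<phi> x) \<le> 1" for x by (simp add: \<phi>_def norm_sgn)
  have L: "\<phi> \<in> Lp_space r" if "1 \<le> r" for r
    by (rule Lp_space_bounded [OF \<phi>m \<phi>1 that])
  have L2: "\<phi> \<in> Lp_space 2" by (rule L) simp
  interpret H: prob_space half_circle by (rule prob_space_half_circle)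
  have int: "(\<integral>I. norm (I + k) \<partial>imag_units_area) = 4 / 3" "integrable imag_units_area (\<lambda>I. norm (I + k))"
    using integral_norm_add_imag_units_powr [OF k, of 1] by auto
  have nz: "\<not> (AE x in bdry_measure. \<phi> x = 0)"
  proof
    assume "AE x in bdry_measure. \<phi> x = 0"
    from AE_bdry_measureD [OF this] AE_half_circle_interior have "AE t in half_circle. False"
    proof eventually_elim
      case (elim t)
      have "AE I in imag_units_area. norm (I + k) = 0"
        using elim(1) AE_space by eventually_elim (use elim(2) in \<open>simp add: \<phi>_slice sgn_zero_iff\<close>)
      then have "(\<integral>I. norm (I + k) \<partial>imag_units_area) = 0"
        by (rule integral_eq_zero_AE)
      then show ?case using int by simp
    qed
    then show False using H.AE_contr [of "\<lambda>x. False"] by auto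
  qed
  have "Lp_norm \<infinity> (slice_average \<phi>) \<le> ennreal m * Lp_norm \<infinity> \<phi>"
    using Lp_norm_slice_proj_le [OF _ L2 L nz, of \<infinity>] m by (simp add: Lp_norm_slice_proj [OF L2])
  also have "\<dots> \<le> ennreal m * ennreal 1"
    by (intro mult_left_mono Lp_norm_bounded [OF \<phi>m \<phi>1]) auto
  finally have "AE x in bdry_measure. ennreal (norm (slice_average \<phi> x)) \<le> ennreal m"
    by (subst (asm) Lp_norm_infinity_le_iff) auto
  from AE_bdry_measureD [OF this] AE_half_circle_interior
    integral_bdry_measure_half(2) [OF Lp_space_2_integrable_self [OF L2]]
  have "AE t in half_circle. False"
  proof eventually_elim
    case (elim t)
    note t = conjunct1 [OF elim(2)] conjunct2 [OF elim(2)]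
    let ?A = "slice_mean \<phi> t" and ?B = "slice_moment \<phi> t"
    have "?A + k * ?B = (\<integral>I. (1 - k * I) * \<phi> (slice_point I t) \<partial>imag_units_area)"
      by (rule slice_average_kernel [OF elim(3)])
    also have "\<dots> = (\<integral>I. norm (I + k) *\<^sub>R k \<partial>imag_units_area)"
    proof (rule Bochner_Integration.integral_cong [OF refl])
      fix I assume "I \<in> space imag_units_area"
      then have I: "I \<in> imag_units" by simp
      have sq: "v * v = - ((norm v)\<^sup>2 *\<^sub>R 1)" if "Re_quat v = 0" for v
        using that by (simp add: quaternion_eq_iff norm_quaternion_def power2_eq_square)
      have "Re_quat (I + k) = 0" using I k by (simp add: imag_units_iff)
      note sq = sq [OF this]
      have "(I + k) * sgn (I + k) = - (norm (I + k) *\<^sub>R 1)"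
        by (cases "I + k = 0") (simp_all add: sgn_div_norm sq power2_eq_square)
      moreover have "1 - k * I = - k * (I + k)"
        using imag_unit_mult_self [OF k] by (simp add: algebra_simps)
      ultimately show "(1 - k * I) * \<phi> (slice_point I t) = norm (I + k) *\<^sub>R k"
        by (simp add: \<phi>_slice [OF I t] mult.assoc)
    qed
    also have "\<dots> = (4 / 3) *\<^sub>R k"
      using int by simp
    finally have AB: "norm (?A + k * ?B) = 4 / 3"
      by (simp add: norm_imag_unit [OF k])
    \<comment> \<open>moving from \<open>k\<close> to \<open>J\<close> changes \<open>A + J B\<close> by \<open>(J - k) B\<close>\<close>
    have far: "AE J in imag_units_area. 4 / 3 - m \<le> norm (J - k) * norm ?B"
      using elim(1) AE_space
    proof eventually_elim
      case (elim J)
      then have "norm (?A + J * ?B) \<le> m"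
        using t m(1) by (simp add: slice_average_slice_point_interior)
      moreover have "?A + k * ?B = (?A + J * ?B) - (J - k) * ?B"
        by (simp add: algebra_simps)
      then have "norm (?A + k * ?B) \<le> norm (?A + J * ?B) + norm ((J - k) * ?B)"
        by (metis norm_triangle_ineq4)
      ultimately show ?case using AB by (simp add: norm_mult)
    qed
    interpret S: prob_space imag_units_area by (rule prob_space_imag_units_area)
    have B: "0 < norm ?B"
    proof (rule ccontr)
      assume "\<not> 0 < norm ?B"
      then have "AE J in imag_units_area. False"
        using far m43 by (auto elim!: eventually_mono)
      then show False using S.AE_contr [of "\<lambda>x. False"] by auto
    qed
    \<comment> \<open>the distance from \<open>k\<close> that almost all \<open>J\<close> would have to keep\<close>
    define \<delta> where "\<delta> = (4 / 3 - m) / norm ?B"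
    have \<delta>: "0 < \<delta>" using B m43 by (simp add: \<delta>_def)
    have "AE J in imag_units_area. J \<bullet> k \<le> 1 - \<delta>\<^sup>2 / 2"
      using far AE_space
    proof eventually_elim
      case (elim J)
      then have J: "J \<in> imag_units" by simp
      have "\<delta> \<le> norm (J - k)"
        using elim B by (simp add: \<delta>_def pos_divide_le_eq)
      then have "\<delta>\<^sup>2 \<le> (norm (J - k))\<^sup>2"
        using \<delta> by (intro power_mono) auto
      also have "\<dots> = 2 - 2 * (J \<bullet> k)"
        using norm_imag_unit [OF J] norm_imag_unit [OF k]
        by (simp add: power2_norm_eq_inner inner_diff_left inner_diff_right inner_commute norm_eq_1)
      finally show ?case by simp
    qed
    from AE_imag_units_area_inner_le [OF k this] \<delta> show ?case by simp
  qed
  then show False using H.AE_contr [of "\<lambda>x. False"] by auto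
qed

theorem theorem1:
  shows "(slice_proj_norm 2 = 1 \<and> slice_proj_norm \<infinity> = 4 / 3) \<and>
    ((\<forall>p::real. 2 \<le> p \<longrightarrow> slice_proj_norm (ennreal p) \<le> ennreal (slice_proj_bound p)) \<and>
      slice_proj_norm \<infinity> \<le> 4 / 3) \<and>
    (\<forall>p q :: ennreal. 1 \<le> p \<longrightarrow> 1 \<le> q \<longrightarrow> 1 / p + 1 / q = 1 \<longrightarrow>
      slice_proj_norm p = slice_proj_norm q)"
proof -
  have two: "slice_proj_norm 2 = 1"
    using slice_proj_norm_2_le slice_proj_norm_ge_1 [of 2] by simp
  have "ennreal (4 / 3) = 4 / 3"
    using divide_ennreal [of 4 3] by simp
  then have inf: "slice_proj_norm \<infinity> = 4 / 3"
    using slice_proj_norm_infinity_le slice_proj_norm_infinity_ge by (metis antisym)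
  have bound: "slice_proj_norm (ennreal p) \<le> ennreal (slice_proj_bound p)" if "2 \<le> p" for p
    using slice_proj_norm_le_bound [of p] that by simp
  have dual: "slice_proj_norm p = slice_proj_norm q" if "1 \<le> p" "1 \<le> q" "1 / p + 1 / q = 1" for p q
    using slice_proj_norm_conjugate_le [OF that] slice_proj_norm_conjugate_le [of q p] that
    by (simp add: add.commute antisym)
  show ?thesis
    using two inf bound dual by auto
qed

end
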